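(* Let $d\ge 1$ be an integer and let $T\colon W^1_1(\mathbb{T}^d)\to L_2(\mathbb{T}^d)$ be a bounded linear translation invariant operator, with $(\lambda_n)_{n\in\mathbb{Z}^d}$ the complex sequence such that $\widehat{T(f)}(n)=\lambda_n\cdot\widehat{f}(n)$ for all $f\in W^1_1(\mathbb{T}^d)$ and $n\in\mathbb{Z}^d$. Then for any $\varepsilon>0$, $$\sum_{n\in\mathbb{Z}^d\setminus\{0\}}\left(\frac{|\lambda_n|}{|n|_2}\right)^{2d+4+\varepsilon}<\infty.$$
   Context: $\mathbb{T}^d=\mathbb{R}^d/\mathbb{Z}^d$ is the $d$-dimensional torus with normalized Haar measure, $\widehat{f}(n)$ ($n\in\mathbb{Z}^d$) are Fourier coefficients, and $|n|_2$ is the Euclidean norm of $n$. $W^1_1(\mathbb{T}^d)$ is the Sobolev space of (complex-valued) functions $f\in L_1(\mathbb{T}^d)$ whose first-order weak partial derivatives belong to $L_1(\mathbb{T}^d)$, with norm $\|f\|_{1,1}=\|f\|_1+\sum_{j=1}^d\left\|\frac{\partial f}{\partial x_j}\right\|_1$. Translation invariant means commuting with all translations of $\mathbb{T}^d$; equivalently, acting as the Fourier multiplier displayed in the claim. *)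

theory Defs
  imports "HOL-Analysis.Analysis"
begin

text \<open>
  The dimension is \<open>d = CARD('d)\<close>, and \<open>\<int>\<^sup>d\<close> is the type \<open>int^'d\<close>. Functions on the torus
  \<open>\<real>\<^sup>d / \<int>\<^sup>d\<close> are represented by \<open>\<int>\<^sup>d\<close>-periodic functions on \<open>\<real>\<^sup>d\<close>. Integrals over the torus are
  taken over the fundamental domain \<open>[0,1)\<^sup>d\<close>, on which normalized Haar measure is Lebesgue measure.
\<close>

definition of_int_vec :: "int^'d \<Rightarrow> real^'d"
  where "of_int_vec n = (\<chi> i. of_int (n $ i))"

definition periodic :: "(real^'d \<Rightarrow> complex) \<Rightarrow> bool"
  where "periodic f \<longleftrightarrow> (\<forall>n x. f (x + of_int_vec n) = f x)"

definition torus :: "(real^'d) measure"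
  where "torus = lebesgue_on {x. \<forall>i. 0 \<le> x $ i \<and> x $ i < 1}"

definition ae_eq :: "(real^'d \<Rightarrow> complex) \<Rightarrow> (real^'d \<Rightarrow> complex) \<Rightarrow> bool"
  where "ae_eq f g \<longleftrightarrow> (AE x in torus. f x = g x)"

definition L1 :: "(real^'d \<Rightarrow> complex) set"
  where "L1 = {f. periodic f \<and> integrable torus f}"

definition L1_norm :: "(real^'d \<Rightarrow> complex) \<Rightarrow> real"
  where "L1_norm f = (LINT x|torus. cmod (f x))"

definition L2 :: "(real^'d \<Rightarrow> complex) set"
  where "L2 = {f. periodic f \<and> f \<in> borel_measurable torus \<and> integrable torus (\<lambda>x. (cmod (f x))\<^sup>2)}"

definition L2_norm :: "(real^'d \<Rightarrow> complex) \<Rightarrow> real"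
  where "L2_norm f = sqrt (LINT x|torus. (cmod (f x))\<^sup>2)"

definition fourier_coeff :: "(real^'d \<Rightarrow> complex) \<Rightarrow> int^'d \<Rightarrow> complex"
  where "fourier_coeff f n = (LINT x|torus. f x * cis (- 2 * pi * (of_int_vec n \<bullet> x)))"

definition partial_deriv :: "'d \<Rightarrow> (real^'d \<Rightarrow> complex) \<Rightarrow> real^'d \<Rightarrow> complex"
  where "partial_deriv j f x = frechet_derivative f (at x) (axis j 1)"

text \<open>
  A function is smooth iff all its iterated partial derivatives exist and are (Frechet)
  differentiable everywhere; continuity of each of them then follows.
\<close>

definition test_functions :: "(real^'d \<Rightarrow> complex) set"
  where "test_functions =
    {\<phi>. periodic \<phi> \<and> (\<forall>js x. foldr partial_deriv js \<phi> differentiable (at x))}"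

definition has_weak_partial :: "'d \<Rightarrow> (real^'d \<Rightarrow> complex) \<Rightarrow> (real^'d \<Rightarrow> complex) \<Rightarrow> bool"
  where "has_weak_partial j f g \<longleftrightarrow>
    (\<forall>\<phi>\<in>test_functions.
      (LINT x|torus. f x * partial_deriv j \<phi> x) = - (LINT x|torus. g x * \<phi> x))"

definition W11 :: "(real^'d \<Rightarrow> complex) set"
  where "W11 = {f \<in> L1. \<forall>j. \<exists>g\<in>L1. has_weak_partial j f g}"

text \<open>Weak derivatives are unique up to null sets, so the choice does not affect the norm.\<close>

definition weak_partial :: "'d \<Rightarrow> (real^'d \<Rightarrow> complex) \<Rightarrow> real^'d \<Rightarrow> complex"
  where "weak_partial j f = (SOME g. g \<in> L1 \<and> has_weak_partial j f g)"

definition W11_norm :: "(real^'d \<Rightarrow> complex) \<Rightarrow> real"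
  where "W11_norm f = L1_norm f + (\<Sum>j\<in>UNIV. L1_norm (weak_partial j f))"

text \<open>
  An operator on equivalence classes of functions is given by its action on representatives;
  all identities between functions in the target space are therefore almost-everywhere identities.
\<close>

definition bounded_linear_operator :: "((real^'d \<Rightarrow> complex) \<Rightarrow> (real^'d \<Rightarrow> complex)) \<Rightarrow> bool"
  where "bounded_linear_operator T \<longleftrightarrow>
    (\<forall>f\<in>W11. T f \<in> L2) \<and>
    (\<forall>f\<in>W11. \<forall>g\<in>W11. ae_eq f g \<longrightarrow> ae_eq (T f) (T g)) \<and>
    (\<forall>f\<in>W11. \<forall>g\<in>W11. ae_eq (T (\<lambda>x. f x + g x)) (\<lambda>x. T f x + T g x)) \<and>
    (\<forall>c. \<forall>f\<in>W11. ae_eq (T (\<lambda>x. c * f x)) (\<lambda>x. c * T f x)) \<and>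
    (\<exists>C. \<forall>f\<in>W11. L2_norm (T f) \<le> C * W11_norm f)"

definition translate :: "real^'d \<Rightarrow> (real^'d \<Rightarrow> complex) \<Rightarrow> real^'d \<Rightarrow> complex"
  where "translate y f = (\<lambda>x. f (x - y))"

definition translation_invariant :: "((real^'d \<Rightarrow> complex) \<Rightarrow> (real^'d \<Rightarrow> complex)) \<Rightarrow> bool"
  where "translation_invariant T \<longleftrightarrow>
    (\<forall>y. \<forall>f\<in>W11. ae_eq (T (translate y f)) (translate y (T f)))"

end

theory Submission
  imports Defs
begin

text \<open>
  Put \<open>a n = |lam n| / |n|\<close>. By Bessel's inequality, testing \<open>T\<close> on a trigonometric polynomial \<open>f\<close> bounds
  \<open>\<Sum> |lam n|\<^sup>2 |f^(n)|\<^sup>2\<close> by the square of the \<open>W11\<close> norm of \<open>f\<close>. Two families of \<open>f\<close> bound the number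
  of \<open>n\<close> with \<open>a n \<ge> t\<close>.

  A Fejer-type kernel with frequencies of size about \<open>R\<close> has norm \<open>O(R)\<close>, so every dyadic block contains
  at most \<open>O(t^-2)\<close> of these \<open>n\<close>.

  If \<open>n_0, ..., n_(K-1)\<close> grow fast and their directions agree up to \<open>1/K\<close>, integrate the Riesz product
  with these frequencies along the largest coordinate. Its differential is, up to a bounded error, a constant
  vector times the Riesz product, so its norm stays bounded in \<open>K\<close>, which forces \<open>K = O(t^-2)\<close>. Choosing
  \<open>K\<close> slightly larger, split the frequencies into \<open>O(K^(d-1))\<close> cones of aperture \<open>1/K\<close> and into residue
  classes modulo \<open>3 K\<close> of the index of the dyadic block: each part meets fewer than \<open>K\<close> blocks. Altogether
  at most \<open>O(K^(d-1) K K t^-2) = O(t^(-2 d - 4))\<close> frequencies satisfy \<open>a n \<ge> t\<close>.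
\<close>

section \<open>Integration over the torus\<close>

text \<open>A Riesz product has L1 norm 1 however many factors it has, while its coefficients at the
  chosen frequencies keep a fixed size. That is how an L1-type norm can detect the number of
  frequencies. The obstacle is the dimension. For d = 1 an antiderivative of the Riesz product has
  the product (minus its mean) as derivative. For larger d the k-th term of the gradient carries the
  direction of \<open>n k\<close>, and increments of a Riesz product with varying multipliers need
  not stay bounded in L1. If the directions differ by at most 1/K, the K errors, each of L1 norm at
  most 1/K, add up to O(1); this fixes the aperture of the cones. The modulus 3 K comes from the
  terms in which the partial product is differentiated. Its derivative is bounded only by 2^k times
  its top frequency, so the frequencies must grow by more than K 2^K; blocks 3 K apart give about
  8^K. The count O(t^(-2 d - 4)) is a weak-type bound, summable only for exponents strictly above 2
  d + 4: hence the positive epsilon. \<open>W11_norm\<close> involves a chosen weak derivative, so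
  its value on trigonometric polynomials depends on the uniqueness theorem for Fourier
  coefficients.\<close>

definition unit_cell :: "(real^'d) set"
  where "unit_cell = {x. \<forall>i. 0 \<le> x $ i \<and> x $ i < 1}"

lemma torus_eq: "torus = lebesgue_on unit_cell"
  by (simp add: torus_def unit_cell_def)

lemma unit_cell_borel [measurable]: "unit_cell \<in> sets borel"
proof -
  have eq: "unit_cell = (\<Inter>i. {x::real^'d. 0 \<le> x $ i} \<inter> {x. x $ i < 1})"
    by (auto simp: unit_cell_def)
  have "{x::real^'d. 0 \<le> x $ i} \<in> sets borel" for i
    by (intro borel_closed closed_Collect_le continuous_intros)
  moreover have "{x::real^'d. x $ i < 1} \<in> sets borel" for i
    by (intro borel_open open_Collect_less continuous_intros)
  ultimately show ?thesis
    unfolding eq by (intro sets.finite_INT sets.Int) auto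
qed

lemma space_torus [simp]: "space torus = unit_cell"
  by (simp add: torus_eq)

lemma unit_cell_subset: "unit_cell \<subseteq> cbox 0 (1 :: real^'d)"
  by (auto simp: unit_cell_def mem_box_cart) (metis less_imp_le)

lemma emeasure_unit_cell: "emeasure lborel (unit_cell :: (real^'d) set) = 1"
proof (rule antisym)
  have one: "(\<Prod>b\<in>Basis. (1::real^'d) \<bullet> b) = 1"
    by (intro prod.neutral) (auto simp: Basis_vec_def inner_axis)
  have "emeasure lborel (unit_cell :: (real^'d) set) \<le> emeasure lborel (cbox 0 (1 :: real^'d))"
    by (intro emeasure_mono unit_cell_subset) auto
  then show "emeasure lborel (unit_cell :: (real^'d) set) \<le> 1"
    using one by (simp add: emeasure_lborel_cbox_eq Basis_vec_def inner_axis split: if_splits)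
  have "box 0 (1::real^'d) \<subseteq> unit_cell"
    by (auto simp: unit_cell_def mem_box_cart) (metis less_imp_le)
  then have "emeasure lborel (box 0 (1 :: real^'d)) \<le> emeasure lborel (unit_cell :: (real^'d) set)"
    by (intro emeasure_mono) auto
  moreover have "emeasure lborel (box 0 (1 :: real^'d)) = 1"
    using one by (subst emeasure_lborel_box_eq) (auto simp: Basis_vec_def inner_axis)
  ultimately show "1 \<le> emeasure lborel (unit_cell :: (real^'d) set)"
    by simp
qed

lemma emeasure_torus: "emeasure (torus :: (real^'d) measure) unit_cell = 1"
  by (simp add: torus_eq emeasure_restrict_space emeasure_unit_cell)

lemma finite_measure_torus: "finite_measure torus"
  by (rule finite_measureI) (simp add: emeasure_torus)

interpretation torus: finite_measure torus
  by (rule finite_measure_torus)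

lemma measure_torus [simp]: "measure (torus :: (real^'d) measure) unit_cell = 1"
  by (simp add: measure_def emeasure_torus)

lemma borel_measurable_torus:
  "f \<in> borel_measurable borel \<Longrightarrow> f \<in> borel_measurable torus"
  by (simp add: torus_eq measurable_completion measurable_restrict_space1)

lemma continuous_measurable_torus:
  fixes f :: "real^'d \<Rightarrow> 'b::real_normed_vector"
  shows "continuous_on UNIV f \<Longrightarrow> f \<in> borel_measurable torus"
  by (intro borel_measurable_torus borel_measurable_continuous_onI)

lemma continuous_integrable_torus [intro]:
  fixes f :: "real^'d \<Rightarrow> 'b::{banach, second_countable_topology}"
  assumes "continuous_on UNIV f"
  shows "integrable torus f"
proof -
  have "compact (f ` cbox 0 1)"
    using assms by (intro compact_continuous_image) (auto intro: continuous_on_subset)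
  then obtain B where B: "\<And>x. x \<in> cbox 0 1 \<Longrightarrow> norm (f x) \<le> B"
    by (force dest: compact_imp_bounded simp: bounded_iff)
  show ?thesis
    using B unit_cell_subset
    by (intro torus.integrable_const_bound[where B=B] AE_I2 continuous_measurable_torus assms) auto
qed

text \<open>\<open>torus\<close> carries the Lebesgue sigma-algebra, while the splitting into
  one-dimensional integrals is available for \<open>lborel\<close>. For Borel integrands the two
  agree.\<close>

lemma integral_torus_lborel:
  fixes f :: "real^'d \<Rightarrow> 'b::{banach, second_countable_topology}"
  assumes [measurable]: "f \<in> borel_measurable borel"
  shows "(LINT x|torus. f x) = (LINT x|lborel. indicator unit_cell x *\<^sub>R f x)"
  unfolding torus_eq by (subst integral_restrict_space) (auto simp: integral_completion)

lemma integrable_torus_lborel: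
  fixes f :: "real^'d \<Rightarrow> 'b::{banach, second_countable_topology}"
  assumes [measurable]: "f \<in> borel_measurable borel"
  shows "integrable torus f \<longleftrightarrow> integrable lborel (\<lambda>x. indicator unit_cell x *\<^sub>R f x)"
  unfolding torus_eq by (subst integrable_restrict_space) (auto simp: integrable_completion)

lemma periodic_axis:
  assumes "periodic h"
  shows "h (x + axis j 1) = h x"
proof -
  have "of_int_vec (axis j 1) = axis j 1"
    by (simp add: of_int_vec_def axis_def vec_eq_iff)
  then show ?thesis
    using assms unfolding periodic_def by metis
qed

lemma has_vector_derivative_line:
  assumes "h differentiable (at (z + y *\<^sub>R axis j 1))"
  shows "((\<lambda>y. h (z + y *\<^sub>R axis j 1)) has_vector_derivative
           partial_deriv j h (z + y *\<^sub>R axis j 1)) (at y within S)"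
proof -
  have "(h has_derivative frechet_derivative h (at (z + y *\<^sub>R axis j 1)))
          (at (z + y *\<^sub>R axis j 1))"
    using assms frechet_derivative_works by blast
  then have "((\<lambda>y. h (z + y *\<^sub>R axis j 1)) has_derivative
      (\<lambda>t. frechet_derivative h (at (z + y *\<^sub>R axis j 1)) (t *\<^sub>R axis j 1))) (at y within S)"
    by (intro has_derivative_compose[of "\<lambda>y. z + y *\<^sub>R axis j 1" _ y S h])
       (auto intro!: derivative_eq_intros simp: has_derivative_at_withinI)
  then show ?thesis
    using linear_frechet_derivative[OF assms]
    by (simp add: has_vector_derivative_def partial_deriv_def linear_scale)
qed

lemma integral_partial_deriv_line:
  fixes h :: "real^'d \<Rightarrow> complex"
  assumes "periodic h" "\<And>x. h differentiable (at x)" and cont: "continuous_on UNIV (partial_deriv j h)"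
  shows "(LINT y|lborel. indicator {0..<1} y *\<^sub>R partial_deriv j h (z + y *\<^sub>R axis j 1)) = 0"
proof -
  have "(LINT y|lborel. indicator {0..<1::real} y *\<^sub>R partial_deriv j h (z + y *\<^sub>R axis j 1))
      = (LINT y|lborel. indicator {0..1::real} y *\<^sub>R partial_deriv j h (z + y *\<^sub>R axis j 1))"
  \<comment> \<open>The fundamental theorem of calculus is stated for a closed interval; the added
    endpoint 1 is a null set.\<close>
  proof (rule integral_cong_AE)
    have "(\<lambda>y. partial_deriv j h (z + y *\<^sub>R axis j 1)) \<in> borel_measurable borel"
      by (intro borel_measurable_continuous_onI continuous_on_compose2[OF cont] continuous_intros) auto
    then show "(\<lambda>y. indicator {0..<1::real} y *\<^sub>R partial_deriv j h (z + y *\<^sub>R axis j 1))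
                 \<in> borel_measurable lborel"
      "(\<lambda>y. indicator {0..1::real} y *\<^sub>R partial_deriv j h (z + y *\<^sub>R axis j 1))
                 \<in> borel_measurable lborel"
      by measurable
    show "AE y in lborel. indicator {0..<1::real} y *\<^sub>R partial_deriv j h (z + y *\<^sub>R axis j 1)
        = indicator {0..1::real} y *\<^sub>R partial_deriv j h (z + y *\<^sub>R axis j 1)"
      using AE_lborel_singleton[of "1::real"] by eventually_elim (auto simp: indicator_def)
  qed
  also have "\<dots> = h (z + 1 *\<^sub>R axis j 1) - h (z + 0 *\<^sub>R axis j 1)"
    by (rule integral_FTC_atLeastAtMost)
       (auto intro!: has_vector_derivative_line assms continuous_on_compose2[OF cont] continuous_intros)
  also have "\<dots> = 0"
    by (simp add: periodic_axis assms)
  finally show ?thesis .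
qed

text \<open>By Fubini, integrate along coordinate \<open>j\<close> before the others: each line
  integral is a difference of two values of \<open>h\<close> one period apart. Both the
  orthogonality of the characters and integration by parts rest on this.\<close>

lemma integral_partial_deriv_torus:
  fixes h :: "real^'d \<Rightarrow> complex"
  assumes "periodic h" "\<And>x. h differentiable (at x)" and cont: "continuous_on UNIV (partial_deriv j h)"
  shows "(LINT x|torus. partial_deriv j h x) = 0"
proof -
  define b :: "real^'d" where "b = axis j 1"
  have b: "b \<in> Basis" by (auto simp: b_def Basis_vec_def)
  define G where "G x = indicator unit_cell x *\<^sub>R partial_deriv j h x" for x
  \<comment> \<open>\<open>\<Phi>\<close> assembles a vector from its coordinates;
    \<open>lborel\<close> is the image under it of a product of one-dimensional Lebesgue measures,
    from which the factor for \<open>b\<close> can be split off.\<close>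
  define \<Phi> :: "(real^'d \<Rightarrow> real) \<Rightarrow> real^'d" where "\<Phi> f = (\<Sum>b\<in>Basis. f b *\<^sub>R b)" for f
  have [measurable]: "partial_deriv j h \<in> borel_measurable borel"
    by (rule borel_measurable_continuous_onI[OF cont])
  have [measurable]: "G \<in> borel_measurable borel"
    unfolding G_def by measurable
  interpret P: product_sigma_finite "\<lambda>_::real^'d. lborel :: real measure"
    by standard
  have distr: "(lborel :: (real^'d) measure) = distr (\<Pi>\<^sub>M b\<in>Basis. lborel) borel \<Phi>"
    unfolding \<Phi>_def by (rule lborel_eq)
  have [measurable]: "\<Phi> \<in> measurable (\<Pi>\<^sub>M b\<in>Basis. lborel) borel"
    unfolding \<Phi>_def by measurable
  have int: "integrable lborel G"
    unfolding G_def using cont by (subst integrable_torus_lborel[symmetric]) auto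
  have ins: "insert b (Basis - {b}) = Basis"
    using b by auto
  have intP: "integrable (Pi\<^sub>M (insert b (Basis - {b})) (\<lambda>_. lborel)) (\<lambda>f. G (\<Phi> f))"
    using int unfolding ins by (subst (asm) distr, subst (asm) integrable_distr_eq) auto
  have inner: "(LINT y|lborel. G (\<Phi> (f(b := y)))) = 0" for f
  proof -
    define z where "z = (\<Sum>c\<in>Basis-{b}. f c *\<^sub>R c)"
    have \<Phi>: "\<Phi> (f(b := y)) = z + y *\<^sub>R axis j 1" for y
      unfolding \<Phi>_def z_def using b by (subst sum.remove[of _ b]) (auto simp: b_def)
    have "c $ j = 0" if "c \<in> Basis - {b}" for c
      using that by (auto simp: Basis_vec_def b_def axis_def)
    then have zj: "z $ j = 0"
      by (simp add: z_def)
    \<comment> \<open>The cell is a product of intervals. Since \<open>z $ j = 0\<close> already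
      lies in [0,1), membership of \<open>z\<close> itself expresses the conditions on the remaining
      coordinates.\<close>
    have "indicator unit_cell (z + y *\<^sub>R axis j 1) = (indicator {0..<1} y * indicator unit_cell z :: real)" for y
    proof -
      have "(z + y *\<^sub>R axis j 1) $ i = (if i = j then y else z $ i)" for i
        using zj by (simp add: axis_def)
      then have "z + y *\<^sub>R axis j 1 \<in> unit_cell \<longleftrightarrow> y \<in> {0..<1} \<and> z \<in> unit_cell"
        using zj by (auto simp: unit_cell_def)
      then show ?thesis by (simp add: indicator_def)
    qed
    then have "G (\<Phi> (f(b := y))) = (indicator unit_cell z :: real) *\<^sub>R
        (indicator {0..<1} y *\<^sub>R partial_deriv j h (z + y *\<^sub>R axis j 1))" for y
      by (simp add: G_def \<Phi>)
    then show ?thesis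
      by (simp only: integral_scaleR_right integral_partial_deriv_line[OF assms] scaleR_zero_right)
  qed
  have "(LINT x|torus. partial_deriv j h x) = (LINT x|lborel. G x)"
    unfolding G_def by (rule integral_torus_lborel) simp
  also have "\<dots> = (LINT f|(\<Pi>\<^sub>M b\<in>Basis. lborel). G (\<Phi> f))"
    by (subst distr, subst integral_distr) auto
  also have "\<dots> = (LINT f|Pi\<^sub>M (Basis - {b}) (\<lambda>_. lborel). LINT y|lborel. G (\<Phi> (f(b := y))))"
    using P.product_integral_insert[OF _ _ intP] unfolding ins by simp
  also have "\<dots> = 0"
    by (simp add: inner)
  finally show ?thesis .
qed

section \<open>Trigonometric polynomials\<close>

lemma partial_deriv_eqI:
  assumes "(f has_derivative f') (at x)"
  shows "partial_deriv j f x = f' (axis j 1)"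
  using frechet_derivative_at[OF assms] by (simp add: partial_deriv_def)

lemma partial_deriv_const [simp]: "partial_deriv j (\<lambda>x. c) = (\<lambda>x. 0)"
  by (simp add: partial_deriv_def fun_eq_iff)

lemma partial_deriv_add:
  assumes "f differentiable (at x)" "g differentiable (at x)"
  shows "partial_deriv j (\<lambda>x. f x + g x) x = partial_deriv j f x + partial_deriv j g x"
  using partial_deriv_eqI[OF has_derivative_add] assms
  by (simp add: frechet_derivative_works partial_deriv_def)

lemma partial_deriv_mult:
  assumes "f differentiable (at x)" "g differentiable (at x)"
  shows "partial_deriv j (\<lambda>x. f x * g x) x = f x * partial_deriv j g x + partial_deriv j f x * g x"
  using partial_deriv_eqI[OF has_derivative_mult] assms
  by (simp add: frechet_derivative_works partial_deriv_def)

lemma partial_deriv_cmult: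
  assumes "f differentiable (at x)"
  shows "partial_deriv j (\<lambda>x. c * f x) x = c * partial_deriv j f x"
  using partial_deriv_mult[OF differentiable_const assms] by simp

lemma partial_deriv_sum:
  assumes "finite A" "\<And>k. k \<in> A \<Longrightarrow> f k differentiable (at x)"
  shows "partial_deriv j (\<lambda>x. \<Sum>k\<in>A. f k x) x = (\<Sum>k\<in>A. partial_deriv j (f k) x)"
  using assms by (induction A) (auto simp: partial_deriv_add differentiable_sum)

section \<open>Characters of the torus and their orthogonality\<close>

definition char :: "int^'d \<Rightarrow> real^'d \<Rightarrow> complex"
  where "char n x = cis (2 * pi * (of_int_vec n \<bullet> x))"

lemma of_int_vec_0 [simp]: "of_int_vec 0 = 0"
  and of_int_vec_add: "of_int_vec (m + n) = of_int_vec m + of_int_vec n"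
  and of_int_vec_minus: "of_int_vec (- n) = - of_int_vec n"
  and of_int_vec_nth [simp]: "of_int_vec n $ i = of_int (n $ i)"
  by (simp_all add: of_int_vec_def vec_eq_iff)

lemma of_int_vec_eq_0_iff [simp]: "of_int_vec n = 0 \<longleftrightarrow> n = 0"
  by (simp add: of_int_vec_def vec_eq_iff)

lemma char_0 [simp]: "char 0 = (\<lambda>x. 1)"
  by (simp add: char_def fun_eq_iff)

lemma char_add: "char (m + n) x = char m x * char n x"
  by (simp add: char_def of_int_vec_add inner_add_left distrib_left cis_mult)

lemma cnj_char: "cnj (char n x) = char (- n) x"
  by (simp add: char_def of_int_vec_minus cis_cnj)

lemma norm_char [simp]: "cmod (char n x) = 1"
  by (simp add: char_def)

lemma periodic_char: "periodic (char n)"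
proof -
  have "of_int_vec n \<bullet> of_int_vec m = of_int (\<Sum>i\<in>UNIV. n $ i * m $ i)" for m :: "int^'a"
    by (simp add: inner_vec_def)
  then have "cis (2 * pi * (of_int_vec n \<bullet> of_int_vec m)) = 1" for m :: "int^'a"
    by (simp only: cis_multiple_2pi Ints_of_int)
  then show ?thesis
    by (simp add: periodic_def char_def inner_add_right distrib_left flip: cis_mult)
qed

lemma has_derivative_char:
  "(char n has_derivative (\<lambda>h. (2 * pi * (of_int_vec n \<bullet> h)) *\<^sub>R (\<i> * char n x))) (at x)"
proof -
  have "((\<lambda>t. exp (\<i> * of_real t)) has_vector_derivative (\<i> * exp (\<i> * of_real t0))) (at t0)" for t0
    by (rule has_vector_derivative_real_field[of "\<lambda>z. exp (\<i> * z)"]) (auto intro!: derivative_eq_intros)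
  moreover have "cis = (\<lambda>t. exp (\<i> * of_real t))"
    by (simp add: cis_conv_exp fun_eq_iff)
  ultimately have "(cis has_vector_derivative (\<i> * cis t0)) (at t0)" for t0
    by (simp add: cis_conv_exp[of t0])
  then have "(cis has_derivative (\<lambda>t. t *\<^sub>R (\<i> * cis t0))) (at t0)" for t0
    by (simp add: has_vector_derivative_def)
  from has_derivative_compose[OF _ this, of "\<lambda>x. 2 * pi * (of_int_vec n \<bullet> x)"
      "\<lambda>h. 2 * pi * (of_int_vec n \<bullet> h)" x UNIV]
  show ?thesis
    unfolding char_def by (auto intro!: derivative_eq_intros)
qed

lemma char_differentiable [simp]: "char n differentiable (at x)"
  using has_derivative_char differentiable_def by blast

lemma partial_deriv_char:
  "partial_deriv j (char n) = (\<lambda>x. 2 * pi * \<i> * of_int (n $ j) * char n x)"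
  by (simp add: fun_eq_iff partial_deriv_eqI[OF has_derivative_char] inner_axis scaleR_conv_of_real)

lemma char_continuous: "continuous_on UNIV (char n)"
  by (simp add: differentiable_imp_continuous_within continuous_at_imp_continuous_on)

text \<open>If \<open>n $ j\<close> is nonzero, the character is a nonzero multiple of its own
  \<open>j\<close>-th partial derivative, whose integral vanishes.\<close>

lemma integral_char: "(LINT x|torus. char n x) = (if n = 0 then 1 else 0)"
proof (cases "n = 0")
  case False
  then obtain j where j: "n $ j \<noteq> 0" by (auto simp: vec_eq_iff)
  have "(LINT x|torus. partial_deriv j (char n) x) = 0"
    by (intro integral_partial_deriv_torus periodic_char)
       (auto simp: partial_deriv_char char_continuous intro!: continuous_intros)
  then show ?thesis
    using j False by (simp add: partial_deriv_char)
qed simp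

lemma fourier_coeff_char_alt: "fourier_coeff f n = (LINT x|torus. f x * char (- n) x)"
  by (simp add: fourier_coeff_def char_def of_int_vec_minus)

text \<open>The set \<open>A\<close> only has to contain the spectrum. Carrying it along makes the
  vanishing of Fourier coefficients outside \<open>A\<close> available without computing any
  coefficient, and the inductive form reduces closure properties to single characters.\<close>

inductive_set trig_poly :: "(int^'d) set \<Rightarrow> (real^'d \<Rightarrow> complex) set" for A where
  trig_zero: "(\<lambda>x. 0) \<in> trig_poly A"
| trig_Cons: "n \<in> A \<Longrightarrow> f \<in> trig_poly A \<Longrightarrow> (\<lambda>x. c * char n x + f x) \<in> trig_poly A"

lemma trig_mono: "f \<in> trig_poly A \<Longrightarrow> A \<subseteq> B \<Longrightarrow> f \<in> trig_poly B"
  by (induction rule: trig_poly.induct) (auto intro: trig_poly.intros)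

lemma trig_char: "n \<in> A \<Longrightarrow> char n \<in> trig_poly A"
  using trig_Cons[OF _ trig_zero, of n A 1] by simp

lemma trig_const: "0 \<in> A \<Longrightarrow> (\<lambda>x. c) \<in> trig_poly A"
  using trig_Cons[OF _ trig_zero, of 0 A c] by simp

lemma trig_add: "f \<in> trig_poly A \<Longrightarrow> g \<in> trig_poly A \<Longrightarrow> (\<lambda>x. f x + g x) \<in> trig_poly A"
proof (induction rule: trig_poly.induct)
  case (trig_Cons n f c)
  then show ?case
    using trig_poly.trig_Cons[of n A "\<lambda>x. f x + g x" c] by (simp add: add.assoc)
qed simp

lemma trig_char_mult:
  assumes "f \<in> trig_poly A" "\<And>n. n \<in> A \<Longrightarrow> m + n \<in> B"
  shows "(\<lambda>x. c * char m x * f x) \<in> trig_poly B"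
  using assms
proof (induction rule: trig_poly.induct)
  case (trig_Cons n f b)
  then have "(\<lambda>x. (c * b) * char (m + n) x + c * char m x * f x) \<in> trig_poly B"
    by (intro trig_poly.trig_Cons) auto
  then show ?case
    by (simp add: char_add algebra_simps)
qed (simp add: trig_zero)

lemma trig_cmult: "f \<in> trig_poly A \<Longrightarrow> (\<lambda>x. c * f x) \<in> trig_poly A"
  using trig_char_mult[of f A 0 A c] by simp

lemma trig_sum:
  "finite I \<Longrightarrow> (\<And>i. i \<in> I \<Longrightarrow> f i \<in> trig_poly A) \<Longrightarrow> (\<lambda>x. \<Sum>i\<in>I. f i x) \<in> trig_poly A"
  by (induction rule: finite_induct) (auto intro: trig_zero trig_add)

lemma trig_mult: "f \<in> trig_poly UNIV \<Longrightarrow> g \<in> trig_poly UNIV \<Longrightarrow> (\<lambda>x. f x * g x) \<in> trig_poly UNIV"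
proof (induction rule: trig_poly.induct)
  case (trig_Cons n f c)
  have "(\<lambda>x. c * char n x * g x + f x * g x) \<in> trig_poly UNIV"
    using trig_Cons by (intro trig_add trig_char_mult[of g UNIV]) auto
  then show ?case
    by (simp add: distrib_right)
qed (simp add: trig_zero)

lemma trig_periodic: "f \<in> trig_poly A \<Longrightarrow> periodic f"
  by (induction rule: trig_poly.induct)
     (simp_all add: periodic_def periodic_char[unfolded periodic_def, rule_format])

lemma trig_differentiable: "f \<in> trig_poly A \<Longrightarrow> f differentiable (at x)"
  by (induction rule: trig_poly.induct) auto

lemma trig_continuous: "f \<in> trig_poly A \<Longrightarrow> continuous_on UNIV f"
  by (meson trig_differentiable differentiable_imp_continuous_within continuous_at_imp_continuous_on)

lemma trig_partial_deriv: "f \<in> trig_poly A \<Longrightarrow> partial_deriv j f \<in> trig_poly A"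
proof (induction rule: trig_poly.induct)
  case (trig_Cons n f c)
  have "partial_deriv j (\<lambda>x. c * char n x + f x)
      = (\<lambda>x. (c * (2 * pi * \<i> * of_int (n $ j))) * char n x + partial_deriv j f x)"
    using trig_differentiable[OF trig_Cons(2)]
    by (simp add: fun_eq_iff partial_deriv_add partial_deriv_cmult partial_deriv_char)
  then show ?case
    using trig_poly.trig_Cons trig_Cons by metis
qed (simp add: trig_zero)

lemma trig_test_function: "f \<in> trig_poly A \<Longrightarrow> f \<in> test_functions"
proof -
  assume f: "f \<in> trig_poly A"
  have "foldr partial_deriv js f \<in> trig_poly A" for js
    by (induction js) (auto intro: f trig_partial_deriv)
  then show ?thesis
    using f by (auto simp: test_functions_def intro: trig_periodic trig_differentiable)
qed

lemma trig_integrable: "f \<in> trig_poly A \<Longrightarrow> integrable torus f"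
  by (intro continuous_integrable_torus trig_continuous)

lemma trig_L1: "f \<in> trig_poly A \<Longrightarrow> f \<in> L1"
  by (simp add: L1_def trig_periodic trig_integrable)

section \<open>Fourier coefficients and weak derivatives of trigonometric polynomials\<close>

lemma integrable_mult_char:
  assumes f: "integrable torus f"
  shows "integrable torus (\<lambda>x. f x * char n x)"
proof (rule Bochner_Integration.integrable_bound[OF f])
  show "(\<lambda>x. f x * char n x) \<in> borel_measurable torus"
    by (intro borel_measurable_times borel_measurable_integrable[OF f]
        continuous_measurable_torus char_continuous)
qed (simp add: norm_mult)

lemma fourier_coeff_add:
  assumes "integrable torus f" "integrable torus g"
  shows "fourier_coeff (\<lambda>x. f x + g x) n = fourier_coeff f n + fourier_coeff g n"
  using assms by (simp add: fourier_coeff_char_alt distrib_right integrable_mult_char)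

lemma fourier_coeff_cmult: "fourier_coeff (\<lambda>x. c * f x) n = c * fourier_coeff f n"
  by (simp add: fourier_coeff_char_alt mult.assoc)

lemma fourier_coeff_sum:
  assumes "finite I" "\<And>i. i \<in> I \<Longrightarrow> integrable torus (f i)"
  shows "fourier_coeff (\<lambda>x. \<Sum>i\<in>I. f i x) n = (\<Sum>i\<in>I. fourier_coeff (f i) n)"
  using assms by (simp add: fourier_coeff_char_alt sum_distrib_right integrable_mult_char)

lemma fourier_coeff_char: "fourier_coeff (char m) n = (if m = n then 1 else 0)"
proof -
  have "fourier_coeff (char m) n = (LINT x|torus. char (m - n) x)"
    by (simp add: fourier_coeff_char_alt flip: char_add)
  then show ?thesis by (simp add: integral_char)
qed

lemma fourier_coeff_char_mult: "fourier_coeff (\<lambda>x. char m x * f x) n = fourier_coeff f (n - m)"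
  by (simp add: fourier_coeff_char_alt mult_ac flip: char_add) 

lemma fourier_coeff_trig_eq_0: "f \<in> trig_poly A \<Longrightarrow> n \<notin> A \<Longrightarrow> fourier_coeff f n = 0"
proof (induction rule: trig_poly.induct)
  case trig_zero
  then show ?case by (simp add: fourier_coeff_char_alt)
next
  case (trig_Cons m f c)
  have "(\<lambda>x. c * char m x) \<in> trig_poly A"
    by (intro trig_cmult trig_char trig_Cons)
  then have "fourier_coeff (\<lambda>x. c * char m x + f x) n = c * fourier_coeff (char m) n + fourier_coeff f n"
    using trig_Cons(2) by (simp add: fourier_coeff_add fourier_coeff_cmult trig_integrable)
  then show ?case
    using trig_Cons by (auto simp: fourier_coeff_char)
qed

text \<open>Integration by parts: the product with a test function is periodic and continuously
  differentiable in direction \<open>j\<close>, so the integral of its derivative vanishes.\<close>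

lemma has_weak_partial_trig:
  assumes f: "f \<in> trig_poly A"
  shows "has_weak_partial j f (partial_deriv j f)"
  unfolding has_weak_partial_def
proof
  fix \<phi> :: "real^'a \<Rightarrow> complex" assume "\<phi> \<in> test_functions"
  then have per: "periodic \<phi>" and d: "foldr partial_deriv js \<phi> differentiable (at x)" for js x
    by (auto simp: test_functions_def)
  have d0: "\<phi> differentiable (at x)" and d1: "partial_deriv j \<phi> differentiable (at x)" for x
    using d[of "[]"] d[of "[j]"] by auto
  have c0: "continuous_on UNIV \<phi>" and c1: "continuous_on UNIV (partial_deriv j \<phi>)"
    using d0 d1 by (meson differentiable_imp_continuous_within continuous_at_imp_continuous_on)+
  note cf = trig_continuous[OF f] trig_continuous[OF trig_partial_deriv[OF f, of j]]
  have pd: "partial_deriv j (\<lambda>x. f x * \<phi> x) = (\<lambda>x. f x * partial_deriv j \<phi> x + partial_deriv j f x * \<phi> x)"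
    using trig_differentiable[OF f] d0 by (simp add: fun_eq_iff partial_deriv_mult)
  have "(LINT x|torus. partial_deriv j (\<lambda>x. f x * \<phi> x) x) = 0"
  proof (rule integral_partial_deriv_torus)
    show "periodic (\<lambda>x. f x * \<phi> x)"
      using per trig_periodic[OF f] by (simp add: periodic_def)
    show "(\<lambda>x. f x * \<phi> x) differentiable (at x)" for x
      using trig_differentiable[OF f] d0 by simp
    show "continuous_on UNIV (partial_deriv j (\<lambda>x. f x * \<phi> x))"
      unfolding pd by (intro continuous_intros c0 c1 cf)
  qed
  moreover have "integrable torus (\<lambda>x. f x * partial_deriv j \<phi> x)"
    "integrable torus (\<lambda>x. partial_deriv j f x * \<phi> x)"
    by (intro continuous_integrable_torus continuous_intros c0 c1 cf)+
  ultimately show "(LINT x|torus. f x * partial_deriv j \<phi> x) = - (LINT x|torus. partial_deriv j f x * \<phi> x)"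
    unfolding pd by (simp add: add_eq_0_iff2)
qed

lemma trig_W11: "f \<in> trig_poly A \<Longrightarrow> f \<in> W11"
  unfolding W11_def using has_weak_partial_trig trig_L1 trig_partial_deriv by blast

section \<open>Uniqueness of Fourier coefficients\<close>

lemma integral_trig_eq_0:
  assumes u: "integrable torus u" and zero: "\<And>n. fourier_coeff u n = 0" and f: "f \<in> trig_poly A"
  shows "(LINT x|torus. u x * f x) = 0" and "integrable torus (\<lambda>x. u x * f x)"
proof -
  have "integrable torus (\<lambda>x. u x * f x) \<and> (LINT x|torus. u x * f x) = 0"
    using f
  proof induction
    case (trig_Cons n f c)
    have "integrable torus (\<lambda>x. c * (u x * char n x))"
      using integrable_mult_char[OF u] by auto
    moreover have "(LINT x|torus. c * (u x * char n x)) = 0"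
      using zero[of "-n"] by (simp add: fourier_coeff_char_alt)
    ultimately show ?case
      using trig_Cons by (simp add: distrib_left mult.left_commute)
  qed simp
  then show "(LINT x|torus. u x * f x) = 0" "integrable torus (\<lambda>x. u x * f x)"
    by auto
qed

text \<open>
  Trigonometric polynomials do not separate opposite faces of the closed unit cube, so the theorem of
  Stone and Weierstrass is applied on the image of the torus in \<open>\<complex>\<^sup>d\<close>.
\<close>

definition torus_embed :: "real^'d \<Rightarrow> complex^'d"
  where "torus_embed x = (\<chi> j. cis (2 * pi * x $ j))"

lemma continuous_torus_embed: "continuous_on S torus_embed"
  unfolding torus_embed_def cis_conv_exp
  by (intro continuous_on_vec_lambda continuous_intros)

lemma inj_torus_embed: "inj_on torus_embed unit_cell"
proof (rule inj_onI)
  fix x y :: "real^'d"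
  assume xy: "x \<in> unit_cell" "y \<in> unit_cell" and eq: "torus_embed x = torus_embed y"
  have "x $ j = y $ j" for j
  proof -
    have "cis (2 * pi * x $ j) = cis (2 * pi * y $ j)"
      using eq by (simp add: torus_embed_def vec_eq_iff)
    then have "cis (2 * pi * (x $ j - y $ j)) = 1"
      by (simp add: right_diff_distrib flip: cis_divide)
    then have "cos (2 * pi * (x $ j - y $ j)) = 1"
      by (metis cis.sel(1) one_complex.sel(1))
    then obtain k :: int where "2 * pi * (x $ j - y $ j) = 2 * pi * k"
      by (auto simp: cos_one_2pi_int mult_ac)
    then have "x $ j - y $ j = k" by simp
    moreover have "\<bar>x $ j - y $ j\<bar> < 1"
    proof -
      have "0 \<le> x $ j" "x $ j < 1" "0 \<le> y $ j" "y $ j < 1"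
        using xy by (auto simp: unit_cell_def)
      then show ?thesis by linarith
    qed
    ultimately have "\<bar>real_of_int k\<bar> < 1" by simp
    then have "k = 0" by linarith
    then show ?thesis using \<open>x $ j - y $ j = k\<close> by simp
  qed
  then show "x = y" by (simp add: vec_eq_iff)
qed

lemma char_axis: "char (axis j 1) x = cis (2 * pi * x $ j)"
proof -
  have "of_int_vec (axis j 1) = axis j 1"
    by (simp add: vec_eq_iff axis_def)
  then show ?thesis by (simp add: char_def inner_axis')
qed

text \<open>A real-linear functional of the embedded point is a combination of the cosines and sines
  of its coordinates, hence of the characters of \<open>axis j 1\<close> and its negative. Sums and
  products stay within trigonometric polynomials.\<close>

lemma trig_real_polynomial_function:
  fixes p :: "complex^'d \<Rightarrow> real"
  assumes "real_polynomial_function p"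
  shows "(\<lambda>x. of_real (p (torus_embed x))) \<in> trig_poly UNIV"
  using assms
proof induction
  case (linear L)
  then have L: "linear L" by (rule bounded_linear.linear)
  have "of_real (L (torus_embed x)) =
      (\<Sum>j\<in>UNIV. (of_real (L (axis j 1)) / 2) * (char (axis j 1) x + char (- axis j 1) x)
          + (of_real (L (axis j \<i>)) / (2 * \<i>)) * (char (axis j 1) x + (-1) * char (- axis j 1) x))" for x
  proof -
    have ax: "axis j z = Re z *\<^sub>R axis j 1 + Im z *\<^sub>R axis j \<i>" for j :: 'd and z
      by (auto simp: vec_eq_iff axis_def complex_eq_iff)
    have emb: "torus_embed x = (\<Sum>j\<in>UNIV. axis j (cis (2 * pi * x $ j)))"
      by (simp add: vec_eq_iff torus_embed_def axis_def if_distrib sum.delta cong: if_cong)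
    have "L (torus_embed x) = (\<Sum>j\<in>UNIV. cos (2 * pi * x $ j) * L (axis j 1) + sin (2 * pi * x $ j) * L (axis j \<i>))"
      unfolding emb linear_sum[OF L]
      by (subst ax) (simp add: linear_add[OF L] linear_scale[OF L])
    moreover have "char (axis j 1) x + char (- axis j 1) x = 2 * of_real (cos (2 * pi * x $ j))"
      "char (axis j 1) x + (-1) * char (- axis j 1) x = 2 * \<i> * of_real (sin (2 * pi * x $ j))" for j
      by (simp_all add: char_axis complex_eq_iff flip: cnj_char)
    ultimately show ?thesis by (auto intro!: sum.cong simp: mult_ac)
  qed
  then show ?case
    by (simp only:)
       (intro trig_sum trig_add trig_cmult trig_char UNIV_I finite)
next
  case (const c)
  then show ?case by (simp add: trig_const)
next
  case (add f g)
  then show ?case by (simp add: trig_add)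
next
  case (mult f g)
  then show ?case by (simp add: trig_mult)
qed

text \<open>The integral vanishes when \<Phi> is replaced by a polynomial. A polynomial uniformly
  within \<open>e\<close> of \<Phi> on the compact image of the closed cube changes the integral by
  at most \<open>e\<close> times the L1 norm of \<open>u\<close>.\<close>

lemma integral_continuous_torus_eq_0:
  fixes \<Phi> :: "complex^'d \<Rightarrow> real"
  assumes u: "integrable torus u" and zero: "\<And>n. fourier_coeff u n = 0" and \<Phi>: "continuous_on UNIV \<Phi>"
  shows "(LINT x|torus. u x * of_real (\<Phi> (torus_embed x))) = 0"
proof -
  have int: "integrable torus (\<lambda>x. u x * of_real (\<Phi> (torus_embed x)))"
  proof -
    have c: "continuous_on UNIV (\<lambda>x. \<Phi> (torus_embed x))"
      by (intro continuous_on_compose2[OF \<Phi> continuous_torus_embed]) auto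
    have "compact ((\<lambda>x. \<Phi> (torus_embed x)) ` cbox 0 1)"
      by (intro compact_continuous_image continuous_on_subset[OF c]) auto
    then obtain B where B: "\<And>x. x \<in> cbox 0 1 \<Longrightarrow> \<bar>\<Phi> (torus_embed x)\<bar> \<le> B"
      by (force dest: compact_imp_bounded simp: bounded_iff)
    have uB: "integrable torus (\<lambda>x. of_real B * u x)"
      using u by simp
    show ?thesis
    proof (rule Bochner_Integration.integrable_bound[OF uB])
      show "(\<lambda>x. u x * of_real (\<Phi> (torus_embed x))) \<in> borel_measurable torus"
        by (intro borel_measurable_times borel_measurable_integrable[OF u] continuous_measurable_torus
            continuous_intros c)
      have "cmod (u x * of_real (\<Phi> (torus_embed x))) \<le> cmod (of_real B * u x)" if "x \<in> unit_cell" for x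
      proof -
        have "\<bar>\<Phi> (torus_embed x)\<bar> \<le> \<bar>B\<bar>"
          using B[of x] that unit_cell_subset by fastforce
        from mult_right_mono[OF this norm_ge_zero[of "u x"]] show ?thesis
          by (simp add: norm_mult mult.commute)
      qed
      then show "AE x in torus. cmod (u x * of_real (\<Phi> (torus_embed x))) \<le> cmod (of_real B * u x)"
        by (intro AE_I2) auto
    qed
  qed
  have "cmod (LINT x|torus. u x * of_real (\<Phi> (torus_embed x))) \<le> e * (LINT x|torus. cmod (u x))"
    if "e > 0" for e
  proof -
    have "compact (torus_embed ` cbox 0 (1::real^'d))"
      by (intro compact_continuous_image continuous_torus_embed) auto
    moreover have "continuous_on (torus_embed ` cbox 0 (1::real^'d)) \<Phi>"
      using \<Phi> by (rule continuous_on_subset) auto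
    ultimately obtain p where p: "real_polynomial_function p"
      "\<And>z. z \<in> torus_embed ` cbox 0 (1::real^'d) \<Longrightarrow> \<bar>\<Phi> z - p z\<bar> < e"
      using Stone_Weierstrass_real_polynomial_function[OF _ _ \<open>e > 0\<close>] by metis
    note P = integral_trig_eq_0[OF u zero trig_real_polynomial_function[OF p(1)]]
    have "(LINT x|torus. u x * of_real (\<Phi> (torus_embed x)))
        = (LINT x|torus. u x * of_real (\<Phi> (torus_embed x)) - u x * of_real (p (torus_embed x)))"
      using P int by simp
    also have "cmod \<dots> \<le> (LINT x|torus. e * cmod (u x))"
    proof (rule Bochner_Integration.integral_norm_bound_integral)
      show "integrable torus (\<lambda>x. u x * of_real (\<Phi> (torus_embed x)) - u x * of_real (p (torus_embed x)))"
        using P int by simp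
      show "integrable torus (\<lambda>x. e * cmod (u x))"
        using u by simp
      fix x :: "real^'d" assume "x \<in> space torus"
      then have "\<bar>\<Phi> (torus_embed x) - p (torus_embed x)\<bar> < e"
        using unit_cell_subset by (intro p) auto
      then have "cmod (u x) * \<bar>\<Phi> (torus_embed x) - p (torus_embed x)\<bar> \<le> cmod (u x) * e"
        by (intro mult_left_mono) auto
      then show "cmod (u x * of_real (\<Phi> (torus_embed x)) - u x * of_real (p (torus_embed x))) \<le> e * cmod (u x)"
        by (simp add: norm_mult mult.commute flip: right_diff_distrib of_real_diff)
    qed
    finally show ?thesis by simp
  qed
  then have lim: "\<forall>e>0. cmod (LINT x|torus. u x * of_real (\<Phi> (torus_embed x))) \<le> e * (LINT x|torus. cmod (u x))"
    by blast
  have "cmod (LINT x|torus. u x * of_real (\<Phi> (torus_embed x))) \<le> 0"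
  proof (rule field_le_epsilon)
    fix e :: real assume "e > 0"
    define I where "I = (LINT x|torus. cmod (u x))"
    have "I \<ge> 0" by (simp add: I_def)
    \<comment> \<open>The summand 1 keeps the divisor positive even when \<open>u\<close> has L1
      norm zero.\<close>
    then have "cmod (LINT x|torus. u x * of_real (\<Phi> (torus_embed x))) \<le> e / (I + 1) * I"
      using lim \<open>e > 0\<close> unfolding I_def[symmetric] by (metis add_nonneg_pos divide_pos_pos zero_less_one)
    also have "\<dots> \<le> 0 + e"
      using \<open>e > 0\<close> \<open>I \<ge> 0\<close> by (simp add: field_simps)
    finally show "cmod (LINT x|torus. u x * of_real (\<Phi> (torus_embed x))) \<le> 0 + e" .
  qed
  then show ?thesis by simp
qed

text \<open>The indicator of \<open>C\<close> is the pointwise limit on the cell of continuous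
  functions of the embedded point, namely tent functions of the distance to the image of
  \<open>C\<close>; dominated convergence transfers the vanishing.\<close>

lemma integral_compact_eq_0:
  fixes C :: "(real^'d) set"
  assumes u: "integrable torus u" and zero: "\<And>n. fourier_coeff u n = 0"
    and C: "compact C" "C \<subseteq> unit_cell"
  shows "(LINT x|torus. u x * indicator C x) = 0"
proof (cases "C = {}")
  case False
  define D where "D = torus_embed ` C"
  have D: "closed D" "D \<noteq> {}"
    unfolding D_def using C(1) False
    by (auto intro!: compact_imp_closed compact_continuous_image continuous_torus_embed)
  define \<Phi> where "\<Phi> k z = max 0 (1 - real k * infdist z D)" for k and z :: "complex^'d"
  have cont: "continuous_on UNIV (\<Phi> k)" for k
    unfolding \<Phi>_def by (intro continuous_intros)
  have lim: "(\<lambda>k. \<Phi> k (torus_embed x)) \<longlonglongrightarrow> indicator C x" if x: "x \<in> unit_cell" for x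
  proof (cases "x \<in> C")
    case True
    then show ?thesis by (simp add: \<Phi>_def D_def)
  next
    case False
    \<comment> \<open>This is where points outside \<open>C\<close> are kept apart from
      \<open>C\<close>: the embedding is injective on the half-open cell, though not on its
      closure.\<close>
    have "torus_embed x \<notin> D"
    proof
      assume "torus_embed x \<in> D"
      then obtain y where "y \<in> C" "torus_embed x = torus_embed y" by (auto simp: D_def)
      then show False
        using inj_onD[OF inj_torus_embed] x C(2) False by blast
    qed
    then have pos: "infdist (torus_embed x) D > 0"
      using D by (metis in_closed_iff_infdist_zero infdist_nonneg less_eq_real_def)
    have "\<forall>\<^sub>F k in sequentially. 1 / infdist (torus_embed x) D \<le> real k"
      using filterlim_real_sequentially by (simp add: filterlim_at_top)
    then have "\<forall>\<^sub>F k in sequentially. \<Phi> k (torus_embed x) = 0"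
    proof eventually_elim
      case (elim k)
      then have "1 \<le> real k * infdist (torus_embed x) D"
        using pos by (simp add: field_simps)
      then show ?case by (simp add: \<Phi>_def)
    qed
    then show ?thesis
      using False by (simp add: tendsto_eventually)
  qed
  have "(\<lambda>k. LINT x|torus. u x * of_real (\<Phi> k (torus_embed x))) \<longlonglongrightarrow> (LINT x|torus. u x * of_real (indicator C x))"
  proof (rule integral_dominated_convergence)
    show "integrable torus (\<lambda>x. cmod (u x))" using u by simp
    show "(\<lambda>x. u x * of_real (\<Phi> k (torus_embed x))) \<in> borel_measurable torus" for k
      by (intro borel_measurable_times borel_measurable_integrable[OF u] continuous_measurable_torus
            continuous_intros continuous_on_compose2[OF cont continuous_torus_embed]) auto
    have [measurable]: "C \<in> sets borel"
      using C(1) by (intro borel_closed compact_imp_closed)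
    have "(\<lambda>x. of_real (indicator C x) :: complex) \<in> borel_measurable borel"
      by measurable
    then show "(\<lambda>x. u x * of_real (indicator C x)) \<in> borel_measurable torus"
      by (intro borel_measurable_times borel_measurable_integrable[OF u] borel_measurable_torus)
    show "AE x in torus. (\<lambda>k. u x * of_real (\<Phi> k (torus_embed x))) \<longlonglongrightarrow> u x * of_real (indicator C x)"
      using lim by (intro AE_I2 tendsto_intros) auto
    have "cmod (u x * of_real (\<Phi> k (torus_embed x))) \<le> cmod (u x)" for k x
    proof -
      have "\<bar>\<Phi> k z\<bar> \<le> 1" for z by (auto simp: \<Phi>_def infdist_nonneg)
      then show ?thesis by (simp add: norm_mult mult_left_le)
    qed
    then show "AE x in torus. cmod (u x * of_real (\<Phi> k (torus_embed x))) \<le> cmod (u x)" for k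
      by simp
  qed
  then have "(\<lambda>k. 0 :: complex) \<longlonglongrightarrow> (LINT x|torus. u x * of_real (indicator C x))"
    using integral_continuous_torus_eq_0[OF u zero cont] by simp
  then have "(LINT x|torus. u x * of_real (indicator C x)) = 0"
    using LIMSEQ_const_iff by metis
  then show ?thesis by (simp add: of_real_indicator)
qed simp

text \<open>Up to a null set, the set where \<open>v\<close> is positive is a countable union of
  compact sets. On each of them a positive function has integral zero, so each is null.\<close>

lemma AE_torus_nonpos:
  fixes v :: "real^'d \<Rightarrow> real"
  assumes v: "integrable torus v"
    and C: "\<And>C. compact C \<Longrightarrow> C \<subseteq> unit_cell \<Longrightarrow> (LINT x|torus. v x * indicator C x) = 0"
  shows "AE x in torus. v x \<le> 0"
proof -
  define S where "S = {x \<in> unit_cell. v x > 0}"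
  have "S \<in> sets torus"
    using borel_measurable_less[OF borel_measurable_const borel_measurable_integrable[OF v], of 0]
    by (simp add: S_def pred_def)
  then have "S \<in> sets lebesgue"
    unfolding torus_eq by (subst (asm) sets_restrict_space_iff) auto
  then obtain K N where KN: "fsigma K" "N \<in> null_sets lebesgue" "K \<union> N = S"
    using lebesgue_set_almost_fsigma by metis
  then obtain F :: "nat \<Rightarrow> (real^'d) set" where F: "range F \<subseteq> Collect compact" "K = \<Union>(range F)"
    unfolding fsigma_Union_compact by blast
  have "AE x in torus. x \<notin> F k" for k
  proof -
    have Fk: "compact (F k)" "F k \<subseteq> S" "F k \<subseteq> unit_cell"
      using F KN by (auto simp: S_def)
    have [measurable]: "F k \<in> sets torus"
      unfolding torus_eq using Fk
      by (subst sets_restrict_space_iff) (auto intro!: borel_closed compact_imp_closed)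
    have "integrable torus (\<lambda>x. v x * indicator (F k) x)"
      using integrable_mult_indicator[of "F k" torus v] v by (simp add: mult.commute)
    then have "AE x in torus. v x * indicator (F k) x = 0"
      using Fk C[OF Fk(1,3)]
      by (subst integral_nonneg_eq_0_iff_AE[symmetric]) (auto simp: indicator_def S_def intro!: AE_I2)
    then show ?thesis
      by eventually_elim (use Fk in \<open>auto simp: S_def indicator_def\<close>)
  qed
  then have "AE x in torus. \<forall>k. x \<notin> F k"
    by (simp add: AE_all_countable)
  moreover have "AE x in torus. x \<notin> N"
    using AE_not_in[OF KN(2)] unfolding torus_eq
    by (auto simp: AE_restrict_space_iff elim: eventually_mono)
  ultimately show ?thesis
    using AE_space
  proof eventually_elim
    case (elim x)
    then have "x \<notin> S" "x \<in> unit_cell" using KN(3) F(2) by auto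
    then show ?case by (auto simp: S_def)
  qed
qed

text \<open>Vanishing integrals over compact sets pass to the real and imaginary parts, and both
  signs of each part are then nonpositive almost everywhere.\<close>

lemma fourier_coeff_eq_0_imp_AE:
  fixes u :: "real^'d \<Rightarrow> complex"
  assumes u: "integrable torus u" and zero: "\<And>n. fourier_coeff u n = 0"
  shows "AE x in torus. u x = 0"
proof -
  have int: "integrable torus (\<lambda>x. u x * indicator C x)" if "compact C" for C
  proof (rule Bochner_Integration.integrable_bound[OF u])
    show "(\<lambda>x. u x * indicator C x) \<in> borel_measurable torus"
      using that by (intro borel_measurable_times borel_measurable_integrable[OF u]
          borel_measurable_torus borel_measurable_indicator) (auto intro!: borel_closed compact_imp_closed)
  qed (auto simp: indicator_def)
  have Re: "(LINT x|torus. Re (u x) * indicator C x) = 0" if "compact C" "C \<subseteq> unit_cell" for C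
  proof -
    have "(LINT x|torus. Re (u x) * indicator C x) = (LINT x|torus. Re (u x * indicator C x))"
      by (intro Bochner_Integration.integral_cong) (auto simp: indicator_def)
    also have "\<dots> = 0"
      by (simp only: integral_Re[OF int[OF that(1)]] integral_compact_eq_0[OF u zero that] zero_complex.sel)
    finally show ?thesis .
  qed
  have Im: "(LINT x|torus. Im (u x) * indicator C x) = 0" if "compact C" "C \<subseteq> unit_cell" for C
  proof -
    have "(LINT x|torus. Im (u x) * indicator C x) = (LINT x|torus. Im (u x * indicator C x))"
      by (intro Bochner_Integration.integral_cong) (auto simp: indicator_def)
    also have "\<dots> = 0"
      by (simp only: integral_Im[OF int[OF that(1)]] integral_compact_eq_0[OF u zero that] zero_complex.sel)
    finally show ?thesis .
  qed
  have "AE x in torus. Re (u x) \<le> 0" "AE x in torus. Im (u x) \<le> 0"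
    "AE x in torus. - Re (u x) \<le> 0" "AE x in torus. - Im (u x) \<le> 0"
    using u Re Im by (intro AE_torus_nonpos; simp)+
  then show ?thesis
    by eventually_elim (simp add: complex_eq_iff)
qed

text \<open>\<open>weak_partial\<close> picks an arbitrary weak derivative. Testing against
  characters shows that it has the same Fourier coefficients as the classical derivative, so the two
  agree almost everywhere.\<close>

lemma weak_partial_trig:
  assumes f: "f \<in> trig_poly A"
  shows "L1_norm (weak_partial j f) = L1_norm (partial_deriv j f)"
proof -
  let ?h = "partial_deriv j f"
  define g where "g = weak_partial j f"
  have h: "?h \<in> L1" by (rule trig_L1[OF trig_partial_deriv[OF f]])
  have "g \<in> L1 \<and> has_weak_partial j f g"
    unfolding g_def weak_partial_def
    by (rule someI[of _ ?h]) (use h has_weak_partial_trig[OF f] in auto)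
  then have g: "integrable torus g" and wg: "has_weak_partial j f g" by (auto simp: L1_def)
  have ih: "integrable torus ?h" using h by (simp add: L1_def)
  have "fourier_coeff (\<lambda>x. g x - ?h x) n = 0" for n
  proof -
    have "char (- n) \<in> test_functions"
      by (rule trig_test_function[OF trig_char[OF UNIV_I]])
    then have "(LINT x|torus. g x * char (- n) x) = (LINT x|torus. ?h x * char (- n) x)"
      using wg has_weak_partial_trig[OF f] unfolding has_weak_partial_def by (metis minus_equation_iff)
    then show ?thesis
      using g ih by (simp add: fourier_coeff_char_alt left_diff_distrib integrable_mult_char)
  qed
  then have "AE x in torus. g x - ?h x = 0"
    using g ih by (intro fourier_coeff_eq_0_imp_AE) auto
  then have "AE x in torus. cmod (g x) = cmod (?h x)"
    by eventually_elim simp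
  then show ?thesis
    unfolding L1_norm_def g_def[symmetric]
    using g ih by (intro integral_cong_AE) (auto intro!: borel_measurable_norm borel_measurable_integrable)
qed

lemma W11_norm_trig:
  "f \<in> trig_poly A \<Longrightarrow> W11_norm f = L1_norm f + (\<Sum>j\<in>UNIV. L1_norm (partial_deriv j f))"
  by (simp add: W11_norm_def weak_partial_trig)

section \<open>Bessel's inequality and the multiplier estimate for trigonometric polynomials\<close>

lemma Bessel_inequality:
  fixes g :: "real^'d \<Rightarrow> complex"
  assumes g: "g \<in> L2" and F: "finite F"
  shows "(\<Sum>n\<in>F. (cmod (fourier_coeff g n))\<^sup>2) \<le> (L2_norm g)\<^sup>2"
proof -
  have meas: "g \<in> borel_measurable torus" and sq: "integrable torus (\<lambda>x. (cmod (g x))\<^sup>2)"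
    using g by (auto simp: L2_def)
  have int: "integrable torus g"
  proof (rule Bochner_Integration.integrable_bound)
    show "integrable torus (\<lambda>x. 1 + (cmod (g x))\<^sup>2)"
      using sq by simp
    \<comment> \<open>On a finite measure space this makes a square-integrable function integrable,
      so its Fourier coefficients are genuine integrals.\<close>
    have "cmod z \<le> 1 + (cmod z)\<^sup>2" for z
      using zero_le_power2[of "cmod z - 1"] zero_le_power2[of "cmod z"] norm_ge_zero[of z]
      unfolding power2_diff power_one mult_1_right by linarith
    then show "AE x in torus. cmod (g x) \<le> norm (1 + (cmod (g x))\<^sup>2)"
      by auto
  qed fact
  define c where "c = fourier_coeff g"
  \<comment> \<open>The partial Fourier sum over \<open>F\<close>. Expanding the square of the L2
    distance from \<open>g\<close> to \<open>s\<close> gives the squared norm of \<open>g\<close>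
    minus \<open>q\<close>, which cannot be negative.\<close>
  define s where "s x = (\<Sum>n\<in>F. c n * char n x)" for x
  have s: "s \<in> trig_poly UNIV"
    unfolding s_def by (intro trig_sum F trig_cmult trig_char UNIV_I)
  define q where "q = (\<Sum>n\<in>F. (cmod (c n))\<^sup>2)"
  have int_cnj: "(LINT x|torus. h x * cnj (s x)) = (\<Sum>n\<in>F. cnj (c n) * fourier_coeff h n)"
    and integrable_cnj: "integrable torus (\<lambda>x. h x * cnj (s x))"
    if h: "integrable torus h" for h
  proof -
    have eq: "(\<lambda>x. h x * cnj (s x)) = (\<lambda>x. \<Sum>n\<in>F. cnj (c n) * (h x * char (-n) x))"
      by (simp add: fun_eq_iff s_def cnj_char sum_distrib_left mult_ac)
    have ints: "integrable torus (\<lambda>x. cnj (c n) * (h x * char (-n) x))" for n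
      by (intro integrable_mult_right integrable_mult_char h)
    show "(LINT x|torus. h x * cnj (s x)) = (\<Sum>n\<in>F. cnj (c n) * fourier_coeff h n)"
      unfolding eq using ints by (subst Bochner_Integration.integral_sum) (simp_all add: fourier_coeff_char_alt)
    show "integrable torus (\<lambda>x. h x * cnj (s x))"
      unfolding eq using ints by (rule Bochner_Integration.integrable_sum)
  qed
  have cc: "(\<Sum>n\<in>F. cnj (c n) * c n) = of_real q"
    unfolding q_def of_real_sum by (intro sum.cong refl) (simp only: complex_norm_square mult.commute)
  have fs: "fourier_coeff s n = c n" if "n \<in> F" for n
  proof -
    have "fourier_coeff s n = (\<Sum>m\<in>F. fourier_coeff (\<lambda>x. c m * char m x) n)"
      unfolding s_def using F
      by (intro fourier_coeff_sum trig_integrable[where A=UNIV] trig_cmult trig_char) auto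
    also have "\<dots> = (\<Sum>m\<in>F. if m = n then c m else 0)"
      by (intro sum.cong) (auto simp: fourier_coeff_cmult fourier_coeff_char)
    finally show ?thesis
      using that F by simp
  qed
  define a where "a x = Re (g x * cnj (s x))" for x
  define b where "b x = Re (s x * cnj (s x))" for x
  note ig = integrable_cnj[OF int] and is' = integrable_cnj[OF trig_integrable[OF s]]
  have "(LINT x|torus. a x) = Re (\<Sum>n\<in>F. cnj (c n) * c n)"
    unfolding a_def integral_Re[OF ig] int_cnj[OF int] by (simp only: c_def)
  then have a: "(LINT x|torus. a x) = q" "integrable torus a"
    using integrable_Re[OF ig] by (simp_all add: cc a_def[abs_def] del: times_complex.sel)
  have "(LINT x|torus. b x) = Re (\<Sum>n\<in>F. cnj (c n) * c n)"
    unfolding b_def integral_Re[OF is'] int_cnj[OF trig_integrable[OF s]]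
    by (intro arg_cong[of _ _ Re] sum.cong refl) (simp only: fs)
  then have b: "(LINT x|torus. b x) = q" "integrable torus b"
    using integrable_Re[OF is'] by (simp_all add: cc b_def[abs_def] del: times_complex.sel)
  have "0 \<le> (LINT x|torus. (cmod (g x - s x))\<^sup>2)"
    by simp
  also have "\<dots> = (LINT x|torus. (cmod (g x))\<^sup>2 - 2 * a x + b x)"
    unfolding a_def b_def
    by (intro Bochner_Integration.integral_cong refl, unfold cmod_power2)
      (simp add: power2_eq_square algebra_simps)
  also have "\<dots> = (LINT x|torus. (cmod (g x))\<^sup>2) - 2 * q + q"
    using sq a b by simp
  finally show ?thesis
    by (simp add: L2_norm_def q_def c_def)
qed

text \<open>This is the form in which the boundedness of the operator enters everything below. It
  mentions neither the operator nor weak derivatives, and finite \<open>F\<close> avoids any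
  question of convergence.\<close>

definition sobolev_multiplier :: "real \<Rightarrow> (int^'d \<Rightarrow> complex) \<Rightarrow> bool"
  where "sobolev_multiplier C lam \<longleftrightarrow>
    (\<forall>f\<in>trig_poly UNIV. \<forall>F. finite F \<longrightarrow>
      (\<Sum>n\<in>F. (cmod (lam n) * cmod (fourier_coeff f n))\<^sup>2)
        \<le> (C * (L1_norm f + (\<Sum>j\<in>UNIV. L1_norm (partial_deriv j f))))\<^sup>2)"

lemma L1_norm_nonneg [simp]: "0 \<le> L1_norm f"
  by (simp add: L1_norm_def)

lemma bounded_imp_sobolev_multiplier:
  assumes T: "bounded_linear_operator T"
    and lam: "\<And>f n. f \<in> W11 \<Longrightarrow> fourier_coeff (T f) n = lam n * fourier_coeff f n"
  shows "\<exists>C\<ge>0. sobolev_multiplier C lam"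
proof -
  obtain C where C: "\<And>f. f \<in> W11 \<Longrightarrow> L2_norm (T f) \<le> C * W11_norm f"
    and L2: "\<And>f. f \<in> W11 \<Longrightarrow> T f \<in> L2"
    using T unfolding bounded_linear_operator_def by blast
  have "(\<Sum>n\<in>F. (cmod (lam n) * cmod (fourier_coeff f n))\<^sup>2)
        \<le> (\<bar>C\<bar> * (L1_norm f + (\<Sum>j\<in>UNIV. L1_norm (partial_deriv j f))))\<^sup>2"
    if f: "f \<in> trig_poly UNIV" and F: "finite F" for f F
  proof -
    have W: "f \<in> W11" by (rule trig_W11[OF f])
    have "(\<Sum>n\<in>F. (cmod (lam n) * cmod (fourier_coeff f n))\<^sup>2) = (\<Sum>n\<in>F. (cmod (fourier_coeff (T f) n))\<^sup>2)"
      by (simp add: lam[OF W] norm_mult)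
    also have "\<dots> \<le> (L2_norm (T f))\<^sup>2"
      by (rule Bessel_inequality[OF L2[OF W] F])
    also have "\<dots> \<le> (C * W11_norm f)\<^sup>2"
      by (intro power_mono C W) (simp add: L2_norm_def)
    \<comment> \<open>The bound of the operator may come with a constant of either sign; later
      monotonicity arguments need a nonnegative one.\<close>
    also have "\<dots> = (\<bar>C\<bar> * W11_norm f)\<^sup>2"
      by (simp add: power_mult_distrib)
    finally show ?thesis by (simp add: W11_norm_trig[OF f])
  qed
  then show ?thesis
    unfolding sobolev_multiplier_def by (intro exI[of _ "\<bar>C\<bar>"]) auto
qed

lemma trig_cnj: "f \<in> trig_poly UNIV \<Longrightarrow> (\<lambda>x. cnj (f x)) \<in> trig_poly UNIV"
proof (induction rule: trig_poly.induct)
  case (trig_Cons n f c)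
  then show ?case
    using trig_poly.trig_Cons[of "-n" UNIV "\<lambda>x. cnj (f x)" "cnj c"] by (simp add: cnj_char)
qed (simp add: trig_zero)

lemma trig_continuous_on: "f \<in> trig_poly A \<Longrightarrow> continuous_on S f"
  by (rule continuous_on_subset[OF trig_continuous]) auto

section \<open>L1 norms of sums and products\<close>

lemma L1_norm_cmult: "L1_norm (\<lambda>x. c * f x) = cmod c * L1_norm f"
  by (simp add: L1_norm_def norm_mult)

lemma L1_norm_add_le:
  assumes "f \<in> trig_poly UNIV" "g \<in> trig_poly UNIV"
  shows "L1_norm (\<lambda>x. f x + g x) \<le> L1_norm f + L1_norm g"
proof -
  have i: "integrable torus (\<lambda>x. cmod (f x))" "integrable torus (\<lambda>x. cmod (g x))"
    using assms by (auto intro: integrable_norm trig_integrable)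
  have "L1_norm (\<lambda>x. f x + g x) \<le> (LINT x|torus. cmod (f x) + cmod (g x))"
    unfolding L1_norm_def using assms i
    by (intro integral_mono integrable_norm trig_integrable[OF trig_add] norm_triangle_ineq) auto
  also have "\<dots> = L1_norm f + L1_norm g"
    unfolding L1_norm_def using i by simp
  finally show ?thesis .
qed

lemma L1_norm_sum_le:
  assumes "finite I" "\<And>i. i \<in> I \<Longrightarrow> f i \<in> trig_poly UNIV"
  shows "L1_norm (\<lambda>x. \<Sum>i\<in>I. f i x) \<le> (\<Sum>i\<in>I. L1_norm (f i))"
  using assms
proof (induction rule: finite_induct)
  case (insert i I)
  have "L1_norm (\<lambda>x. f i x + (\<Sum>i\<in>I. f i x)) \<le> L1_norm (f i) + L1_norm (\<lambda>x. \<Sum>i\<in>I. f i x)"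
    using insert by (intro L1_norm_add_le trig_sum) auto
  with insert show ?case by simp
qed (simp add: L1_norm_def)

lemma L1_norm_mult_le:
  assumes f: "f \<in> trig_poly UNIV" and g: "g \<in> trig_poly UNIV" and B: "\<And>x. cmod (g x) \<le> B"
  shows "L1_norm (\<lambda>x. g x * f x) \<le> B * L1_norm f"
proof -
  have "L1_norm (\<lambda>x. g x * f x) \<le> (LINT x|torus. B * cmod (f x))"
    unfolding L1_norm_def
  proof (rule integral_mono)
    show "integrable torus (\<lambda>x. cmod (g x * f x))"
      using f g by (intro integrable_norm trig_integrable[OF trig_mult])
    show "integrable torus (\<lambda>x. B * cmod (f x))"
      using f by (intro integrable_mult_right integrable_norm trig_integrable)
  qed (use B in \<open>auto simp: norm_mult mult_right_mono\<close>)
  then show ?thesis by (simp add: L1_norm_def)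
qed

lemma L1_norm_le_bound:
  assumes f: "f \<in> trig_poly UNIV" and B: "\<And>x. cmod (f x) \<le> B"
  shows "L1_norm f \<le> B"
proof -
  have "L1_norm f \<le> (LINT x|(torus :: (real^'a) measure). B)"
    unfolding L1_norm_def using f B
    by (intro integral_mono integrable_norm trig_integrable) auto
  then show ?thesis by simp
qed

section \<open>Dyadic blocks\<close>

lemma integral_cmod_square_sum_char:
  assumes "finite A"
  shows "(LINT x|torus. (cmod (\<Sum>k\<in>A. c k * char k x))\<^sup>2) = (\<Sum>k\<in>A. (cmod (c k))\<^sup>2)"
proof -
  have "of_real ((cmod (\<Sum>k\<in>A. c k * char k x))\<^sup>2)
      = (\<Sum>k\<in>A. \<Sum>l\<in>A. (c k * cnj (c l)) * char (k - l) x)" for x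
    unfolding complex_norm_square
    by (simp add: sum_product cnj_char mult_ac flip: char_add)
  then have "complex_of_real (LINT x|torus. (cmod (\<Sum>k\<in>A. c k * char k x))\<^sup>2)
      = (LINT x|torus. (\<Sum>k\<in>A. \<Sum>l\<in>A. (c k * cnj (c l)) * char (k - l) x))"
    by (simp only: integral_complex_of_real[symmetric])
  also have "\<dots> = (\<Sum>k\<in>A. \<Sum>l\<in>A. (c k * cnj (c l)) * (LINT x|torus. char (k - l) x))"
    by (simp add: trig_integrable[OF trig_char[OF UNIV_I]])
  also have "\<dots> = (\<Sum>k\<in>A. \<Sum>l\<in>A. if k = l then c k * cnj (c l) else 0)"
    by (intro sum.cong) (auto simp: integral_char)
  also have "\<dots> = (\<Sum>k\<in>A. c k * cnj (c k))"
    using assms by simp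
  also have "\<dots> = of_real (\<Sum>k\<in>A. (cmod (c k))\<^sup>2)"
    unfolding of_real_sum complex_norm_square by simp
  finally show ?thesis
    by (simp only: of_real_eq_iff)
qed

text \<open>A weighted arithmetic-geometric mean inequality stands in for Cauchy-Schwarz, and
  Parseval evaluates the two squares. The weights \<open>s\<close> and \<open>t\<close> make the
  bound linear in each coefficient size, which the derivative estimates need.\<close>

lemma L1_norm_product_le:
  assumes "finite A" "finite B" and s: "0 < s" "\<And>k. k \<in> A \<Longrightarrow> cmod (a k) \<le> s"
    and t: "0 < t" "\<And>k. k \<in> B \<Longrightarrow> cmod (b k) \<le> t"
  shows "L1_norm (\<lambda>x. (\<Sum>k\<in>A. a k * char k x) * cnj (\<Sum>k\<in>B. b k * char k x)) \<le> s * t * (card A + card B) / 2"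
proof -
  define P where "P x = (\<Sum>k\<in>A. a k * char k x)" for x
  define Q where "Q x = (\<Sum>k\<in>B. b k * char k x)" for x
  have PQ: "P \<in> trig_poly UNIV" "Q \<in> trig_poly UNIV"
    unfolding P_def Q_def using assms(1,2) by (auto intro!: trig_sum trig_cmult trig_char)
  have i: "integrable torus (\<lambda>x. (cmod (P x))\<^sup>2)" "integrable torus (\<lambda>x. (cmod (Q x))\<^sup>2)"
    by (intro continuous_integrable_torus continuous_intros PQ[THEN trig_continuous_on])+
  have "L1_norm (\<lambda>x. P x * cnj (Q x))
      \<le> (LINT x|torus. (s * t / 2) * ((cmod (P x))\<^sup>2 / s\<^sup>2 + (cmod (Q x))\<^sup>2 / t\<^sup>2))"
    unfolding L1_norm_def
  proof (rule integral_mono)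
    show "integrable torus (\<lambda>x. cmod (P x * cnj (Q x)))"
      by (intro integrable_norm trig_integrable[OF trig_mult] trig_cnj PQ)
    show "integrable torus (\<lambda>x. (s * t / 2) * ((cmod (P x))\<^sup>2 / s\<^sup>2 + (cmod (Q x))\<^sup>2 / t\<^sup>2))"
      using i by simp
    have "u * v \<le> (s * t / 2) * (u\<^sup>2 / s\<^sup>2 + v\<^sup>2 / t\<^sup>2)" for u v
    proof -
      have "0 \<le> (s * t / 2) * (u / s - v / t)\<^sup>2"
        using s t by simp
      then show ?thesis
        using s(1) t(1) by (simp add: power2_eq_square field_simps)
    qed
    then show "cmod (P x * cnj (Q x)) \<le> (s * t / 2) * ((cmod (P x))\<^sup>2 / s\<^sup>2 + (cmod (Q x))\<^sup>2 / t\<^sup>2)" for x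
      by (simp add: norm_mult)
  qed
  also have "\<dots> = (s * t / 2) * ((\<Sum>k\<in>A. (cmod (a k))\<^sup>2) / s\<^sup>2 + (\<Sum>k\<in>B. (cmod (b k))\<^sup>2) / t\<^sup>2)"
    using i by (simp add: P_def Q_def integral_cmod_square_sum_char assms)
  also have "\<dots> \<le> (s * t / 2) * (card A + card B)"
  proof -
    have "(\<Sum>k\<in>A. (cmod (a k))\<^sup>2) \<le> card A * s\<^sup>2" "(\<Sum>k\<in>B. (cmod (b k))\<^sup>2) \<le> card B * t\<^sup>2"
      using s t by (auto intro!: sum_bounded_above power_mono)
    then have "(\<Sum>k\<in>A. (cmod (a k))\<^sup>2) / s\<^sup>2 \<le> card A" "(\<Sum>k\<in>B. (cmod (b k))\<^sup>2) / t\<^sup>2 \<le> card B"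
      using s t by (simp_all add: field_simps)
    then show ?thesis
      using s t by (intro mult_left_mono) auto
  qed
  finally show ?thesis
    by (simp add: P_def Q_def)
qed

definition cube :: "int \<Rightarrow> int \<Rightarrow> (int^'d) set"
  where "cube a b = {k. \<forall>i. k $ i \<in> {a..<b}}"

lemma card_cube: "card (cube a b :: (int^'d) set) = nat (b - a) ^ CARD('d)"
  and finite_cube: "finite (cube a b :: (int^'d) set)"
proof -
  have b: "bij_betw (\<lambda>f. \<chi> i. f i) (PiE UNIV (\<lambda>_::'d. {a..<b})) (cube a b)"
    by (rule bij_betw_byWitness[where f'="\<lambda>k i. k $ i"]) (auto simp: cube_def)
  show "card (cube a b :: (int^'d) set) = nat (b - a) ^ CARD('d)"
    using bij_betw_same_card[OF b] by (simp add: card_PiE)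
  show "finite (cube a b :: (int^'d) set)"
    using bij_betw_finite[OF b] by (simp add: finite_PiE)
qed

lemma partial_deriv_sum_char:
  assumes "finite A"
  shows "partial_deriv j (\<lambda>x. \<Sum>k\<in>A. c k * char k x) = (\<lambda>x. \<Sum>k\<in>A. (2 * pi * \<i> * of_int (k $ j) * c k) * char k x)"
  using assms by (simp add: fun_eq_iff partial_deriv_sum partial_deriv_cmult partial_deriv_char mult_ac)

text \<open>The kernel is a normalized product of two Dirichlet kernels with spectra of comparable
  cardinality, in the manner of de la Vallee Poussin. Such a product is bounded in L1 by Parseval
  alone, and the product rule turns a derivative into two products of the same kind with
  coefficients of size O(R).\<close>

lemma block_bound:
  fixes lam :: "int^'d \<Rightarrow> complex"
  assumes lam: "sobolev_multiplier C lam" and "0 \<le> C" and R: "R \<ge> 1" and F: "finite F"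
    and FR: "\<And>n i. n \<in> F \<Longrightarrow> \<bar>n $ i\<bar> \<le> int R"
  shows "(\<Sum>n\<in>F. (cmod (lam n))\<^sup>2) \<le> (C * 3 ^ CARD('d) * (1 + 6 * pi * CARD('d)) * R)\<^sup>2"
proof -
  define B :: "(int^'d) set" where "B = cube 0 (int R)"
  \<comment> \<open>Side lengths R for \<open>B\<close> and 3 R for \<open>E\<close> give the ratio
    \<open>3 ^ CARD('d)\<close> of cardinalities that appears in all the norm bounds.\<close>
  define E :: "(int^'d) set" where "E = cube (- int R) (2 * int R)"
  define M where "M = real (card B)"
  have fin: "finite B" "finite E"
    by (simp_all add: B_def E_def finite_cube)
  have M: "M = R ^ CARD('d)" "real (card E) = 3 ^ CARD('d) * M"
  proof -
    show "M = R ^ CARD('d)" by (simp add: M_def B_def card_cube)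
    moreover have "card E = (3 * R) ^ CARD('d)"
      unfolding E_def card_cube by (simp add: nat_mult_distrib)
    ultimately show "real (card E) = 3 ^ CARD('d) * M"
      by (simp add: power_mult_distrib)
  qed
  have "M > 0" using R by (simp add: M)
  define D where "D x = (\<Sum>k\<in>E. 1 * char k x)" for x
  define G where "G x = (\<Sum>k\<in>B. 1 * char k x)" for x
  have DG: "D \<in> trig_poly UNIV" "G \<in> trig_poly UNIV" "(\<lambda>x. cnj (G x)) \<in> trig_poly UNIV"
    unfolding D_def G_def by (intro trig_sum trig_cmult trig_char trig_cnj fin UNIV_I)+
  \<comment> \<open>The coefficients of \<open>f\<close> on the block are \<open>1\<close> because \<open>n + B \<subseteq> E\<close>.\<close>
  define f where "f x = (1 / of_real M) * (D x * cnj (G x))" for x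
  have f: "f \<in> trig_poly UNIV"
    unfolding f_def by (intro trig_cmult trig_mult DG)
  have fc: "fourier_coeff f n = 1" if "\<And>i. \<bar>n $ i\<bar> \<le> int R" for n
  proof -
    have nE: "n + l \<in> E" if "l \<in> B" for l
      using that \<open>\<And>i. \<bar>n $ i\<bar> \<le> int R\<close> unfolding B_def E_def cube_def
      by (auto simp: abs_le_iff) (smt (verit))+
    have "f x = (\<Sum>l\<in>B. \<Sum>k\<in>E. (1 / of_real M) * char (k - l) x)" for x
    proof -
      have "f x = (1 / of_real M) * ((\<Sum>k\<in>E. char k x) * (\<Sum>l\<in>B. char (- l) x))"
        by (simp add: f_def D_def G_def cnj_char)
      also have "\<dots> = (1 / of_real M) * (\<Sum>l\<in>B. \<Sum>k\<in>E. char (k - l) x)"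
        unfolding sum_product by (subst sum.swap) (simp flip: char_add)
      finally show ?thesis
        by (simp only: sum_distrib_left)
    qed
    then have "f = (\<lambda>x. \<Sum>l\<in>B. \<Sum>k\<in>E. (1 / of_real M) * char (k - l) x)"
      by blast
    then have "fourier_coeff f n = (\<Sum>l\<in>B. \<Sum>k\<in>E. fourier_coeff (\<lambda>x. (1 / of_real M) * char (k - l) x) n)"
      using fin by (simp add: fourier_coeff_sum trig_integrable[OF trig_char[OF UNIV_I]])
    also have "\<dots> = (\<Sum>l\<in>B. \<Sum>k\<in>E. if k = n + l then 1 / of_real M else 0)"
      unfolding fourier_coeff_cmult fourier_coeff_char by (intro sum.cong refl) auto
    also have "\<dots> = (\<Sum>l\<in>B. 1 / of_real M)"
      using fin nE by (intro sum.cong refl) simp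
    also have "\<dots> = 1"
      using \<open>M > 0\<close> by (simp add: M_def)
    finally show ?thesis .
  qed
  have c3: "card E + card B \<le> 2 * (3 ^ CARD('d) * M)" "1 \<le> (3::real) ^ CARD('d)"
    using \<open>M > 0\<close> by (simp_all add: M(2) flip: M_def)
  have n0: "L1_norm f \<le> 3 ^ CARD('d)"
  proof -
    have "L1_norm (\<lambda>x. D x * cnj (G x)) \<le> 1 * 1 * real (card E + card B) / 2"
      unfolding D_def G_def by (intro L1_norm_product_le fin) auto
    also have "\<dots> \<le> 3 ^ CARD('d) * M" using c3 by simp
    finally show ?thesis
      unfolding f_def L1_norm_cmult using \<open>M > 0\<close> by (simp add: norm_divide field_simps)
  qed
  have n1: "L1_norm (partial_deriv j f) \<le> 3 ^ CARD('d) * (6 * pi * R)" for j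
  proof -
    define D' where "D' x = (\<Sum>k\<in>E. (2 * pi * \<i> * of_int (k $ j) * 1) * char k x)" for x
    define G' where "G' x = (\<Sum>k\<in>B. (2 * pi * \<i> * of_int (k $ j) * 1) * char k x)" for x
    have DG': "D' \<in> trig_poly UNIV" "G' \<in> trig_poly UNIV" "(\<lambda>x. cnj (G' x)) \<in> trig_poly UNIV"
      unfolding D'_def G'_def by (intro trig_sum trig_cmult trig_char trig_cnj fin UNIV_I)+
    \<comment> \<open>Conjugation reflects the spectrum; as a sum over the reflected set, the
      conjugate falls under \<open>partial_deriv_sum_char\<close>.\<close>
    have "(\<lambda>x. cnj (G x)) = (\<lambda>x. \<Sum>k\<in>uminus ` B. 1 * char k x)"
      by (simp add: G_def fun_eq_iff cnj_char sum.reindex)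
    then have "partial_deriv j (\<lambda>x. cnj (G x)) = (\<lambda>x. cnj (G' x))"
      using fin by (simp only: partial_deriv_sum_char finite_imageI)
        (simp add: G'_def fun_eq_iff cnj_char sum.reindex)
    moreover have "partial_deriv j D = D'"
      unfolding D_def[abs_def] D'_def[abs_def] using fin by (simp only: partial_deriv_sum_char)
    ultimately have pd: "partial_deriv j f = (\<lambda>x. (1 / of_real M) * (D x * cnj (G' x) + D' x * cnj (G x)))"
      unfolding f_def
      using trig_differentiable[OF DG(1)] trig_differentiable[OF DG(3)]
      by (subst fun_eq_iff, subst partial_deriv_cmult) (auto simp: partial_deriv_mult)
    have absB: "\<bar>real_of_int (k $ j)\<bar> \<le> R" if "k \<in> B" for k
    proof -
      have "0 \<le> k $ j" "k $ j < int R" using that by (auto simp: B_def cube_def)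
      then show ?thesis by linarith
    qed
    have absE: "\<bar>real_of_int (k $ j)\<bar> \<le> 2 * R" if "k \<in> E" for k
    proof -
      have "- int R \<le> k $ j" "k $ j < 2 * int R" using that by (auto simp: E_def cube_def)
      then show ?thesis by linarith
    qed
    \<comment> \<open>Frequencies are at most R on \<open>B\<close> and at most 2 R on
      \<open>E\<close>, so the two terms of the product rule contribute 2 pi R and 4 pi R.\<close>
    have "L1_norm (\<lambda>x. D x * cnj (G' x)) \<le> 1 * (2 * pi * R) * (card E + card B) / 2"
      unfolding D_def G'_def using R
      by (intro L1_norm_product_le fin) (auto simp: norm_mult absB)
    moreover have "L1_norm (\<lambda>x. D' x * cnj (G x)) \<le> (4 * pi * R) * 1 * (card E + card B) / 2"
      unfolding D'_def G_def using R
      by (intro L1_norm_product_le fin) (auto simp: norm_mult dest: absE)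
    ultimately have "L1_norm (\<lambda>x. D x * cnj (G' x)) + L1_norm (\<lambda>x. D' x * cnj (G x))
        \<le> (6 * pi * R) * ((card E + card B) / 2)"
      by (simp add: algebra_simps)
    also have "\<dots> \<le> (6 * pi * R) * (3 ^ CARD('d) * M)"
      using c3 by (intro mult_left_mono) auto
    finally have "L1_norm (\<lambda>x. D x * cnj (G' x) + D' x * cnj (G x)) \<le> (6 * pi * R) * (3 ^ CARD('d) * M)"
      using L1_norm_add_le[OF trig_mult[OF DG(1) DG'(3)] trig_mult[OF DG'(1) DG(3)]] by linarith
    then show ?thesis
      unfolding pd L1_norm_cmult using \<open>M > 0\<close> by (simp add: norm_divide field_simps)
  qed
  have "L1_norm f + (\<Sum>j\<in>UNIV. L1_norm (partial_deriv j f))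
      \<le> 3 ^ CARD('d) + (\<Sum>j\<in>(UNIV::'d set). 3 ^ CARD('d) * (6 * pi * R))"
    by (intro add_mono n0 sum_mono n1)
  also have "\<dots> = 3 ^ CARD('d) * (1 + 6 * pi * CARD('d) * R)"
    by (simp add: algebra_simps)
  also have "\<dots> \<le> 3 ^ CARD('d) * ((1 + 6 * pi * CARD('d)) * R)"
    using R by (intro mult_left_mono) (auto simp: algebra_simps)
  finally have W: "L1_norm f + (\<Sum>j\<in>UNIV. L1_norm (partial_deriv j f))
      \<le> 3 ^ CARD('d) * ((1 + 6 * pi * CARD('d)) * R)" .
  have "(\<Sum>n\<in>F. (cmod (lam n))\<^sup>2) = (\<Sum>n\<in>F. (cmod (lam n) * cmod (fourier_coeff f n))\<^sup>2)"
    using FR by (intro sum.cong refl) (simp add: fc)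
  also have "\<dots> \<le> (C * (L1_norm f + (\<Sum>j\<in>UNIV. L1_norm (partial_deriv j f))))\<^sup>2"
    using lam f F unfolding sobolev_multiplier_def by blast
  also have "\<dots> \<le> (C * (3 ^ CARD('d) * ((1 + 6 * pi * CARD('d)) * R)))\<^sup>2"
    using \<open>0 \<le> C\<close> W by (intro power_mono mult_left_mono) (auto intro!: mult_nonneg_nonneg add_nonneg_nonneg sum_nonneg)
  finally show ?thesis
    by (simp only: mult.assoc)
qed

section \<open>Riesz products\<close>

definition freq :: "int^'d \<Rightarrow> real"
  where "freq n = norm (of_int_vec n)"

lemma freq_0 [simp]: "freq 0 = 0"
  and freq_nonneg [simp]: "0 \<le> freq n"
  and freq_minus [simp]: "freq (- n) = freq n"
  and freq_add_le: "freq (m + n) \<le> freq m + freq n"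
  by (simp_all add: freq_def of_int_vec_minus of_int_vec_add norm_triangle_ineq)

lemma freq_double: "freq (n + n) = 2 * freq n"
  unfolding freq_def of_int_vec_add scaleR_2[symmetric] norm_scaleR by simp

lemma abs_nth_le_freq: "\<bar>of_int (n $ i)\<bar> \<le> freq n"
  using component_le_norm_cart[of "of_int_vec n" i] by (simp add: freq_def)

lemma freq_ge_1: "n \<noteq> 0 \<Longrightarrow> 1 \<le> freq n"
proof -
  assume "n \<noteq> 0"
  then obtain i where "n $ i \<noteq> 0" by (auto simp: vec_eq_iff)
  then have "1 \<le> \<bar>of_int (n $ i) :: real\<bar>" by linarith
  then show ?thesis using abs_nth_le_freq[of n i] by linarith
qed

text \<open>Complex-valued versions of cosine and sine, written through characters so that spectra
  can be tracked with \<open>trig_poly\<close>.\<close>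

definition ccos :: "int^'d \<Rightarrow> real^'d \<Rightarrow> complex"
  where "ccos n x = 1/2 * char n x + 1/2 * char (- n) x"

definition csin :: "int^'d \<Rightarrow> real^'d \<Rightarrow> complex"
  where "csin n x = 1/(2*\<i>) * char n x + (-1/(2*\<i>)) * char (- n) x"

lemma ccos_eq: "ccos n x = of_real (cos (2 * pi * (of_int_vec n \<bullet> x)))"
  and csin_eq: "csin n x = of_real (sin (2 * pi * (of_int_vec n \<bullet> x)))"
  by (simp_all add: ccos_def csin_def char_def of_int_vec_minus complex_eq_iff)

lemma norm_ccos_le: "cmod (ccos n x) \<le> 1" and norm_csin_le: "cmod (csin n x) \<le> 1"
  by (simp_all add: ccos_eq csin_eq)

lemma ccos_trig: "ccos n \<in> trig_poly {n, - n}" and csin_trig: "csin n \<in> trig_poly {n, - n}"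
  unfolding ccos_def[abs_def] csin_def[abs_def] by (intro trig_add trig_cmult trig_char; simp)+

lemma ccos_trig_UNIV: "ccos n \<in> trig_poly UNIV" and csin_trig_UNIV: "csin n \<in> trig_poly UNIV"
  using ccos_trig csin_trig by (blast intro: trig_mono)+

lemma partial_deriv_char_pair:
  "partial_deriv j (\<lambda>x. a * char m x + b * char n x)
    = (\<lambda>x. a * (2 * pi * \<i> * of_int (m $ j) * char m x) + b * (2 * pi * \<i> * of_int (n $ j) * char n x))"
  by (simp add: fun_eq_iff partial_deriv_add partial_deriv_cmult partial_deriv_char)

lemma partial_deriv_ccos: "partial_deriv j (ccos n) = (\<lambda>x. - (2 * pi * of_int (n $ j)) * csin n x)"
  and partial_deriv_csin: "partial_deriv j (csin n) = (\<lambda>x. (2 * pi * of_int (n $ j)) * ccos n x)"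
  unfolding ccos_def[abs_def] csin_def[abs_def] partial_deriv_char_pair
  by (simp_all add: fun_eq_iff field_simps)

text \<open>The Riesz product of the factors 1 + cos(2 pi n_i . x). The step is written as a sum
  because the increment, cosine times the previous product, is what telescopes later.\<close>

primrec riesz :: "(nat \<Rightarrow> int^'d) \<Rightarrow> nat \<Rightarrow> real^'d \<Rightarrow> complex" where
  "riesz n 0 = (\<lambda>x. 1)"
| "riesz n (Suc k) = (\<lambda>x. riesz n k x + ccos (n k) x * riesz n k x)"

text \<open>Serves as the radius of a ball containing the spectrum of the partial Riesz product
  \<open>riesz n k\<close>.\<close>

definition fsum :: "(nat \<Rightarrow> int^'d) \<Rightarrow> nat \<Rightarrow> real"
  where "fsum n k = (\<Sum>i<k. freq (n i))"

lemma fsum_0 [simp]: "fsum n 0 = 0"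
  and fsum_Suc: "fsum n (Suc k) = fsum n k + freq (n k)"
  and fsum_nonneg [simp]: "0 \<le> fsum n k"
  by (simp_all add: fsum_def sum_nonneg)

lemma fsum_mono: "k \<le> l \<Longrightarrow> fsum n k \<le> fsum n l"
  unfolding fsum_def by (intro sum_mono2) auto

lemma freq_le_fsum: "k < l \<Longrightarrow> freq (n k) \<le> fsum n l"
  using fsum_mono[of "Suc k" l n] fsum_nonneg[of n k] by (simp add: fsum_Suc del: fsum_nonneg)

text \<open>Multiplication by a cosine or sine shifts the spectrum by \<open>n\<close> and
  \<open>- n\<close>, so the triangle inequality confines it to a shell around radius
  \<open>freq n\<close>. Shells of fast growing frequencies are disjoint and avoid the
  origin.\<close>

lemma trig_ccos_mult:
  assumes "f \<in> trig_poly {m. freq m \<le> s}"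
  shows "(\<lambda>x. ccos n x * f x) \<in> trig_poly {m. freq n - s \<le> freq m \<and> freq m \<le> freq n + s}"
    and "(\<lambda>x. csin n x * f x) \<in> trig_poly {m. freq n - s \<le> freq m \<and> freq m \<le> freq n + s}"
proof -
  have 1: "freq n - s \<le> freq (n + m) \<and> freq (n + m) \<le> freq n + s"
    "freq n - s \<le> freq (- n + m) \<and> freq (- n + m) \<le> freq n + s" if "freq m \<le> s" for m
    using that freq_add_le[of n m] freq_add_le[of "-n" m] freq_add_le[of "n + m" "- m"]
      freq_add_le[of "- n + m" "- m"] by auto
  show "(\<lambda>x. ccos n x * f x) \<in> trig_poly {m. freq n - s \<le> freq m \<and> freq m \<le> freq n + s}"
    "(\<lambda>x. csin n x * f x) \<in> trig_poly {m. freq n - s \<le> freq m \<and> freq m \<le> freq n + s}"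
    unfolding ccos_def csin_def distrib_right
    by (intro trig_add trig_char_mult[OF assms]; use 1 in auto)+
qed

lemma riesz_trig: "riesz n k \<in> trig_poly {m. freq m \<le> fsum n k}"
proof (induction k)
  case 0
  then show ?case by (simp add: trig_const)
next
  case (Suc k)
  have "(\<lambda>x. ccos (n k) x * riesz n k x) \<in> trig_poly {m. freq m \<le> fsum n (Suc k)}"
    using trig_ccos_mult(1)[OF Suc] by (rule trig_mono) (auto simp: fsum_Suc)
  moreover have "riesz n k \<in> trig_poly {m. freq m \<le> fsum n (Suc k)}"
    using Suc by (rule trig_mono) (auto simp: fsum_Suc intro: order_trans)
  ultimately show ?case by (simp add: trig_add)
qed

lemma riesz_trig_UNIV: "riesz n k \<in> trig_poly UNIV"
  using riesz_trig by (rule trig_mono) simp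

text \<open>Every factor 1 + cos is nonnegative. Equality with the modulus makes the L1 norm equal
  to the integral, which is a Fourier coefficient.\<close>

lemma riesz_nonneg: "riesz n k x = of_real (cmod (riesz n k x))"
proof (induction k)
  case (Suc k)
  define r where "r = cmod (riesz n k x)"
  define c where "c = 1 + cos (2 * pi * (of_int_vec (n k) \<bullet> x))"
  have "c \<ge> 0" unfolding c_def using cos_ge_minus_one[of "2 * pi * (of_int_vec (n k) \<bullet> x)"] by linarith
  have "riesz n (Suc k) x = of_real (r * c)"
    using Suc by (simp add: r_def c_def ccos_eq algebra_simps)
  then show ?case using \<open>c \<ge> 0\<close> by (simp add: r_def norm_mult)
qed simp

lemma norm_riesz_le: "cmod (riesz n k x) \<le> 2 ^ k"
proof (induction k)
  case (Suc k)
  have "cmod (riesz n (Suc k) x) \<le> cmod (riesz n k x) + cmod (ccos (n k) x) * cmod (riesz n k x)"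
    by (simp add: norm_mult norm_triangle_ineq flip: norm_mult)
  also have "\<dots> \<le> cmod (riesz n k x) + 1 * cmod (riesz n k x)"
    by (intro add_left_mono mult_right_mono norm_ccos_le) auto
  finally show ?case using Suc by simp
qed simp

text \<open>Each increment has its spectrum in a shell that misses frequency 0, so the mean never
  moves from 1; by nonnegativity the mean is the L1 norm.\<close>

lemma L1_norm_riesz:
  assumes "\<And>i. i < k \<Longrightarrow> fsum n i < freq (n i)"
  shows "L1_norm (riesz n k) = 1"
proof -
  have "(LINT x|torus. riesz n k x) = 1"
    using assms
  proof (induction k)
    case (Suc k)
    have "fourier_coeff (\<lambda>x. ccos (n k) x * riesz n k x) 0 = 0"
      using Suc.prems[of k] by (intro fourier_coeff_trig_eq_0[OF trig_ccos_mult(1)[OF riesz_trig]]) auto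
    then have "(LINT x|torus. ccos (n k) x * riesz n k x) = 0"
      by (simp add: fourier_coeff_char_alt)
    moreover have "integrable torus (riesz n k)" "integrable torus (\<lambda>x. ccos (n k) x * riesz n k x)"
      by (intro trig_integrable[of _ UNIV] trig_mult riesz_trig_UNIV ccos_trig_UNIV)+
    ultimately show ?case
      using Suc by simp
  qed simp
  also have "(LINT x|torus. riesz n k x) = of_real (L1_norm (riesz n k))"
    unfolding L1_norm_def by (subst riesz_nonneg, rule integral_complex_of_real)
  finally show ?thesis by simp
qed

text \<open>A crude uniform bound: every factor at most doubles the product. The exponential loss is
  affordable because the growth condition of \<open>riesz_bound\<close> contains
  \<open>2 ^ K\<close>.\<close>

lemma norm_partial_deriv_riesz_le:
  "cmod (partial_deriv j (riesz n k) x) \<le> 2 * pi * 2 ^ k * fsum n k"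
proof (induction k)
  case (Suc k)
  note d = trig_differentiable[OF riesz_trig] trig_differentiable[OF ccos_trig]
  have "partial_deriv j (riesz n (Suc k)) x =
      partial_deriv j (riesz n k) x + (ccos (n k) x * partial_deriv j (riesz n k) x
        + (- (2 * pi * of_int (n k $ j)) * csin (n k) x) * riesz n k x)"
    using partial_deriv_add[OF d(1) differentiable_mult[OF d(2,1)]]
    by (simp only: riesz.simps partial_deriv_mult[OF d(2,1)] partial_deriv_ccos)
  also have "cmod \<dots> \<le> cmod (partial_deriv j (riesz n k) x) + (cmod (ccos (n k) x) * cmod (partial_deriv j (riesz n k) x)
        + cmod (- (2 * pi * of_int (n k $ j)) * csin (n k) x) * cmod (riesz n k x))"
    by (intro order.trans[OF norm_triangle_ineq] add_mono order_refl) (simp_all add: norm_mult)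
  also have "\<dots> \<le> 2 * pi * 2 ^ k * fsum n k + (1 * (2 * pi * 2 ^ k * fsum n k) + (2 * pi * freq (n k)) * 2 ^ k)"
  proof (intro add_mono mult_mono Suc norm_ccos_le norm_riesz_le)
    have "cmod (- (2 * pi * of_int (n k $ j)) * csin (n k) x) = 2 * pi * \<bar>of_int (n k $ j)\<bar> * cmod (csin (n k) x)"
      by (simp add: norm_mult)
    also have "\<dots> \<le> 2 * pi * freq (n k) * 1"
      by (intro mult_mono mult_left_mono abs_nth_le_freq norm_csin_le) auto
    finally show "cmod (- (2 * pi * of_int (n k $ j)) * csin (n k) x) \<le> 2 * pi * freq (n k)" by simp
  qed auto
  also have "\<dots> \<le> 2 * pi * 2 ^ Suc k * fsum n (Suc k)"
    by (simp add: fsum_Suc algebra_simps)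
  finally show ?case .
qed simp

lemma fourier_coeff_csin_mult:
  assumes "f \<in> trig_poly A"
  shows "fourier_coeff (\<lambda>x. csin m x * f x) n = (fourier_coeff f (n - m) - fourier_coeff f (n + m)) / (2 * \<i>)"
proof -
  have i: "integrable torus (\<lambda>x. char m x * f x)" for m
    using integrable_mult_char[OF trig_integrable[OF assms]] by (simp add: mult.commute)
  have pair: "fourier_coeff (\<lambda>x. a * (char m x * f x) + b * (char (- m) x * f x)) n
    = a * fourier_coeff f (n - m) + b * fourier_coeff f (n + m)" for a b
    using i by (subst fourier_coeff_add) (simp_all add: fourier_coeff_cmult fourier_coeff_char_mult)
  show ?thesis
    unfolding csin_def distrib_right mult.assoc pair by (simp add: field_simps)
qed

text \<open>In the growth condition \<open>2 ^ K\<close> offsets the uniform bound for derivatives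
  of partial products and K offsets the number of terms. The numbers \<open>\<theta> j\<close> are
  the components of the common direction, normalized so that coordinate \<open>j0\<close> is about
  1.\<close>

lemma riesz_bound:
  fixes lam :: "int^'d \<Rightarrow> complex" and n :: "nat \<Rightarrow> int^'d"
  assumes lam: "sobolev_multiplier C lam" and "0 \<le> C" and K: "K \<ge> 1"
    and growth: "\<And>k. k < K \<Longrightarrow> real K * 2 ^ K * fsum n k < freq (n k)"
    and j0: "\<And>k. k < K \<Longrightarrow> freq (n k) \<le> CARD('d) * \<bar>of_int (n k $ j0)\<bar>"
    and \<theta>: "\<And>k j. k < K \<Longrightarrow> \<bar>of_int (n k $ j) / of_int (n k $ j0) - \<theta> j\<bar> \<le> 1 / K" "\<And>j. \<bar>\<theta> j\<bar> \<le> 1"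
  shows "(\<Sum>k<K. (cmod (lam (n k)) / freq (n k))\<^sup>2)
      \<le> (4 * pi * C * (1 + CARD('d) + CARD('d) * (3 + CARD('d))))\<^sup>2"
proof -
  define d where "d = real CARD('d)"
  have "d \<ge> 1" by (simp add: d_def Suc_leI)
  define w where "w k = real_of_int (n k $ j0)" for k
  have KK: "2 \<le> real K * 2 ^ K"
  proof -
    have "1 * 2 ^ 1 \<le> real K * 2 ^ K"
      using K by (intro mult_mono power_increasing) auto
    then show ?thesis by simp
  qed
  \<comment> \<open>The factor 2 places the shell around \<open>freq (n l)\<close> entirely above
    every earlier frequency, not merely away from the origin.\<close>
  have growth2: "2 * fsum n k < freq (n k)" if "k < K" for k
    using mult_right_mono[OF KK fsum_nonneg, of n k] growth[OF that] by linarith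
  have growth1: "fsum n k < freq (n k)" if "k < K" for k
    using growth2[OF that] fsum_nonneg[of n k] by linarith
  have w: "w k \<noteq> 0" "freq (n k) \<le> d * \<bar>w k\<bar>" "\<bar>w k\<bar> \<le> freq (n k)" "0 < freq (n k)" "1 \<le> \<bar>w k\<bar>" if "k < K" for k
  proof -
    show p: "0 < freq (n k)" using growth1[OF that] fsum_nonneg[of n k] by linarith
    show q: "freq (n k) \<le> d * \<bar>w k\<bar>" using j0[OF that] by (simp add: d_def w_def)
    show r: "w k \<noteq> 0" using p q by auto
    show "\<bar>w k\<bar> \<le> freq (n k)" by (simp add: w_def abs_nth_le_freq)
    have "n k $ j0 \<noteq> 0" using r by (simp add: w_def)
    then show "1 \<le> \<bar>w k\<bar>" unfolding w_def by linarith
  qed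
  have w': "2 ^ K * fsum n k / \<bar>w k\<bar> \<le> d / K" if "k < K" for k
  proof -
    have "real K * 2 ^ K * fsum n k \<le> d * \<bar>w k\<bar>"
      using growth[OF that] w(2)[OF that] by linarith
    then show ?thesis using w(1)[OF that] K by (simp add: field_simps)
  qed
  have L1_riesz: "L1_norm (riesz n k) = 1" if "k \<le> K" for k
    using growth1 that by (intro L1_norm_riesz) auto

  \<comment> \<open>Each increment cos times \<open>riesz n k\<close> is integrated in direction
    \<open>j0\<close> as if only the cosine depended on \<open>x\<close>; dividing by
    \<open>w k\<close> normalizes that component of the gradient.\<close>
  define f where "f x = (\<Sum>k<K. of_real (1 / (2 * pi * w k)) * (csin (n k) x * riesz n k x))" for x
  have ft: "(\<lambda>x. of_real (1 / (2 * pi * w k)) * (csin (n k) x * riesz n k x)) \<in> trig_poly UNIV" for k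
    by (intro trig_cmult trig_mult csin_trig_UNIV riesz_trig_UNIV)
  then have f: "f \<in> trig_poly UNIV"
    unfolding f_def[abs_def] by (intro trig_sum) auto

  have fc: "cmod (fourier_coeff f (n k)) = 1 / (4 * pi * \<bar>w k\<bar>)" if k: "k < K" for k
  proof -
    have other: "fourier_coeff (\<lambda>x. csin (n l) x * riesz n l x) (n k) = 0" if "l < K" "l \<noteq> k" for l
    proof (rule fourier_coeff_trig_eq_0[OF trig_ccos_mult(2)[OF riesz_trig]])
      show "n k \<notin> {m. freq (n l) - fsum n l \<le> freq m \<and> freq m \<le> freq (n l) + fsum n l}"
      proof (cases "l < k")
        case True
        have "freq (n l) + fsum n l \<le> fsum n k"
          using fsum_mono[of "Suc l" k n] True by (simp add: fsum_Suc)
        then show ?thesis using growth1[OF k] by auto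
      next
        case False
        then have "freq (n k) \<le> fsum n l"
          using that by (intro freq_le_fsum) auto
        then show ?thesis using growth2[OF that(1)] by auto
      qed
    qed
    have zero: "fourier_coeff (riesz n k) 0 = 1"
    proof -
      have "fourier_coeff (riesz n k) 0 = (LINT x|torus. complex_of_real (cmod (riesz n k x)))"
        by (simp add: fourier_coeff_char_alt flip: riesz_nonneg)
      also have "\<dots> = of_real (L1_norm (riesz n k))"
        unfolding L1_norm_def by (rule integral_complex_of_real)
      finally show ?thesis using L1_riesz k by simp
    qed
    have two: "fourier_coeff (riesz n k) (n k + n k) = 0"
    proof (rule fourier_coeff_trig_eq_0[OF riesz_trig])
      show "n k + n k \<notin> {m. freq m \<le> fsum n k}"
        unfolding mem_Collect_eq freq_double using growth1[OF k] w(4)[OF k] by linarith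
    qed
    \<comment> \<open>Only the shift by \<open>n k\<close> contributes: it reaches coefficient 0,
      equal to 1, whereas the opposite shift reaches twice \<open>n k\<close>, outside the
      spectrum.\<close>
    have self: "fourier_coeff (\<lambda>x. csin (n k) x * riesz n k x) (n k) = 1 / (2 * \<i>)"
      unfolding fourier_coeff_csin_mult[OF riesz_trig] by (simp only: diff_self zero two diff_zero)
    have "fourier_coeff f (n k) = (\<Sum>l<K. of_real (1 / (2 * pi * w l)) * fourier_coeff (\<lambda>x. csin (n l) x * riesz n l x) (n k))"
      unfolding f_def[abs_def]
      by (subst fourier_coeff_sum) (auto intro!: trig_integrable[OF ft] simp only: fourier_coeff_cmult finite_lessThan)
    also have "\<dots> = (\<Sum>l<K. if l = k then of_real (1 / (2 * pi * w k)) * (1 / (2 * \<i>)) else 0)"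
      using other self by (intro sum.cong refl) auto
    also have "\<dots> = of_real (1 / (2 * pi * w k)) * (1 / (2 * \<i>))"
      using k by simp
    finally show ?thesis
      by (simp add: norm_mult norm_divide abs_mult)
  qed

  have nw: "cmod (complex_of_real (1 / (2 * pi * w k))) = 1 / (2 * pi * \<bar>w k\<bar>)" for k
    unfolding norm_of_real by (simp add: abs_mult)
  have n0: "L1_norm f \<le> 1 + d"
  proof -
    have "L1_norm f \<le> (\<Sum>k<K. L1_norm (\<lambda>x. of_real (1 / (2 * pi * w k)) * (csin (n k) x * riesz n k x)))"
      unfolding f_def[abs_def] using ft by (intro L1_norm_sum_le) auto
    \<comment> \<open>The term k = 0 is separate because \<open>fsum n 0 = 0\<close> gives no growth
      to exploit; it is bounded by 1. For k > 0 the sum \<open>fsum n k\<close> is at least 1, so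
      \<open>w'\<close> applies.\<close>
    also have "\<dots> \<le> (\<Sum>k<K. (if k = 0 then 1 else 0) + d / K)"
    proof (intro sum_mono)
      fix k assume "k \<in> {..<K}"
      then have k: "k < K" by simp
      have "L1_norm (\<lambda>x. csin (n k) x * riesz n k x) \<le> 1 * L1_norm (riesz n k)"
        by (intro L1_norm_mult_le riesz_trig_UNIV csin_trig_UNIV norm_csin_le)
      then have "L1_norm (\<lambda>x. of_real (1 / (2 * pi * w k)) * (csin (n k) x * riesz n k x)) \<le> (1 / (2 * pi * \<bar>w k\<bar>)) * 1"
        unfolding L1_norm_cmult nw using L1_riesz[of k] k
        by (intro mult_mono) auto
      also have "\<dots> \<le> 1 / \<bar>w k\<bar>"
      proof -
        have "1 * \<bar>w k\<bar> \<le> (2 * pi) * \<bar>w k\<bar>"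
          using pi_ge_two by (intro mult_right_mono) auto
        then show ?thesis
          unfolding mult_1_right using w(5)[OF k] by (intro divide_left_mono) auto
      qed
      also have "\<dots> \<le> (if k = 0 then 1 else 0) + d / K"
      proof (cases "k = 0")
        case True
        then show ?thesis using w(5)[OF k] \<open>d \<ge> 1\<close> by (simp add: field_simps add_increasing2)
      next
        case False
        have "n 0 \<noteq> 0" using w(4)[of 0] K by auto
        then have "1 \<le> freq (n 0)" by (rule freq_ge_1)
        then have "1 \<le> fsum n k" using freq_le_fsum[of 0 k n] False by simp
        then have "1 * 1 \<le> 2 ^ K * fsum n k"
          by (intro mult_mono) auto
        then have "1 / \<bar>w k\<bar> \<le> 2 ^ K * fsum n k / \<bar>w k\<bar>"
          by (intro divide_right_mono) auto
        then show ?thesis using w'[OF k] False by simp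
      qed
      finally show "L1_norm (\<lambda>x. of_real (1 / (2 * pi * w k)) * (csin (n k) x * riesz n k x)) \<le> (if k = 0 then 1 else 0) + d / K" .
    qed
    also have "\<dots> = 1 + d"
      using K by (simp add: sum.distrib)
    finally show ?thesis .
  qed

  have n1: "L1_norm (partial_deriv j f) \<le> 3 + d" for j
  proof -
    \<comment> \<open>\<open>g1\<close> telescopes to a full Riesz product, \<open>g2\<close> is small because the directions almost agree, and
      \<open>g3\<close> is small because the frequencies grow fast.\<close>
    define \<alpha> where "\<alpha> k = of_int (n k $ j) / w k - \<theta> j" for k
    define g1 where "g1 x = of_real (\<theta> j) * (riesz n K x + (-1) * 1)" for x
    define g2 where "g2 x = (\<Sum>k<K. of_real (\<alpha> k) * (ccos (n k) x * riesz n k x))" for x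
    define g3 where "g3 x = (\<Sum>k<K. of_real (1 / (2 * pi * w k)) * (csin (n k) x * partial_deriv j (riesz n k) x))" for x
    have one: "(\<lambda>x::real^'d. 1) \<in> trig_poly UNIV" by (rule trig_const) simp
    have g1: "g1 \<in> trig_poly UNIV"
      unfolding g1_def[abs_def] by (intro trig_cmult trig_add riesz_trig_UNIV one)
    have t2: "(\<lambda>x. of_real (\<alpha> k) * (ccos (n k) x * riesz n k x)) \<in> trig_poly UNIV" for k
      by (intro trig_cmult trig_mult ccos_trig_UNIV riesz_trig_UNIV)
    have g2: "g2 \<in> trig_poly UNIV"
      unfolding g2_def[abs_def] using t2 by (intro trig_sum) auto
    have t3: "(\<lambda>x. of_real (1 / (2 * pi * w k)) * (csin (n k) x * partial_deriv j (riesz n k) x)) \<in> trig_poly UNIV" for k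
      by (intro trig_cmult trig_mult csin_trig_UNIV trig_partial_deriv riesz_trig_UNIV)
    have g3: "g3 \<in> trig_poly UNIV"
      unfolding g3_def[abs_def] using t3 by (intro trig_sum) auto
    have tele: "riesz n K x + (-1) * 1 = (\<Sum>k<K. ccos (n k) x * riesz n k x)" for x
      using sum_lessThan_telescope[of "\<lambda>k. riesz n k x" K] by simp
    have "partial_deriv j f x = (g1 x + g2 x) + g3 x" for x
    proof -
      have d: "(\<lambda>x. csin (n k) x * riesz n k x) differentiable (at x)" for k
        by (intro trig_differentiable[of _ UNIV] trig_mult csin_trig_UNIV riesz_trig_UNIV)
      have "partial_deriv j f x = (\<Sum>k<K. of_real (1 / (2 * pi * w k)) *
          (csin (n k) x * partial_deriv j (riesz n k) x + (2 * pi * of_int (n k $ j)) * ccos (n k) x * riesz n k x))"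
        unfolding f_def[abs_def] partial_deriv_sum[OF finite_lessThan trig_differentiable[OF ft]]
        by (simp only: partial_deriv_cmult[OF d] partial_deriv_csin
            partial_deriv_mult[OF trig_differentiable[OF csin_trig] trig_differentiable[OF riesz_trig]])
      \<comment> \<open>The ratio of coordinate \<open>j\<close> to \<open>w k\<close> is split into
        the common value \<open>\<theta> j\<close> and the deviation
        \<open>\<alpha> k\<close>.\<close>
      also have "\<dots> = (\<Sum>k<K. of_real (\<theta> j) * (ccos (n k) x * riesz n k x) + of_real (\<alpha> k) * (ccos (n k) x * riesz n k x)
          + of_real (1 / (2 * pi * w k)) * (csin (n k) x * partial_deriv j (riesz n k) x))"
      proof (intro sum.cong refl)
        have alg: "A * (s + B * q * r) = a * (q * r) + b * (q * r) + A * s"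
          if "A * B = a + b" for A B a b q r s :: complex
        proof -
          have "A * (s + B * q * r) = A * s + (A * B) * (q * r)" by (simp add: algebra_simps)
          then show ?thesis unfolding that by (simp add: distrib_right)
        qed
        fix k assume "k \<in> {..<K}"
        then have "w k \<noteq> 0" using w(1) by simp
        then have "complex_of_real (1 / (2 * pi * w k)) * (2 * pi * of_int (n k $ j)) = of_real (\<theta> j) + of_real (\<alpha> k)"
          by (simp add: \<alpha>_def)
        then show "of_real (1 / (2 * pi * w k)) * (csin (n k) x * partial_deriv j (riesz n k) x
             + (2 * pi * of_int (n k $ j)) * ccos (n k) x * riesz n k x)
           = of_real (\<theta> j) * (ccos (n k) x * riesz n k x) + of_real (\<alpha> k) * (ccos (n k) x * riesz n k x)
          + of_real (1 / (2 * pi * w k)) * (csin (n k) x * partial_deriv j (riesz n k) x)"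
          by (rule alg)
      qed
      also have "\<dots> = (g1 x + g2 x) + g3 x"
        unfolding g1_def g2_def g3_def tele by (simp only: sum.distrib sum_distrib_left)
      finally show ?thesis .
    qed
    then have pd: "partial_deriv j f = (\<lambda>x. (g1 x + g2 x) + g3 x)" by blast
    have b1: "L1_norm g1 \<le> 1 * (1 + 1)"
    proof -
      have "L1_norm (\<lambda>x. riesz n K x + (-1) * 1) \<le> L1_norm (riesz n K) + L1_norm (\<lambda>x::real^'d. (-1) * 1)"
        by (intro L1_norm_add_le riesz_trig_UNIV trig_cmult one)
      also have "\<dots> = 1 + 1" using L1_riesz[of K] by (simp add: L1_norm_def)
      finally show ?thesis
        unfolding g1_def[abs_def] L1_norm_cmult using \<theta>(2)[of j] by (intro mult_mono) auto
    qed
    have b2: "L1_norm g2 \<le> 1"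
    proof -
      have "L1_norm g2 \<le> (\<Sum>k<K. L1_norm (\<lambda>x. of_real (\<alpha> k) * (ccos (n k) x * riesz n k x)))"
        unfolding g2_def[abs_def] using t2 by (intro L1_norm_sum_le) auto
      also have "\<dots> \<le> (\<Sum>k<K. 1 / K * 1)"
      proof (intro sum_mono)
        fix k assume "k \<in> {..<K}"
        then have k: "k < K" by simp
        have "L1_norm (\<lambda>x. ccos (n k) x * riesz n k x) \<le> 1 * L1_norm (riesz n k)"
          by (intro L1_norm_mult_le riesz_trig_UNIV ccos_trig_UNIV norm_ccos_le)
        moreover have "\<bar>\<alpha> k\<bar> \<le> 1 / K"
          using \<theta>(1)[OF k, of j] by (simp add: \<alpha>_def w_def)
        ultimately show "L1_norm (\<lambda>x. of_real (\<alpha> k) * (ccos (n k) x * riesz n k x)) \<le> 1 / K * 1"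
          unfolding L1_norm_cmult norm_of_real using L1_riesz[of k] k
          by (intro mult_mono) auto
      qed
      also have "\<dots> = 1" using K by simp
      finally show ?thesis .
    qed
    have b3: "L1_norm g3 \<le> d"
    proof -
      have "L1_norm g3 \<le> (\<Sum>k<K. L1_norm (\<lambda>x. of_real (1 / (2 * pi * w k)) * (csin (n k) x * partial_deriv j (riesz n k) x)))"
        unfolding g3_def[abs_def] using t3 by (intro L1_norm_sum_le) auto
      also have "\<dots> \<le> (\<Sum>k<K. d / K)"
      proof (intro sum_mono)
        fix k assume "k \<in> {..<K}"
        then have k: "k < K" by simp
        have "L1_norm (\<lambda>x. csin (n k) x * partial_deriv j (riesz n k) x) \<le> 1 * (2 * pi * 2 ^ k * fsum n k)"
        proof (intro L1_norm_le_bound trig_mult csin_trig_UNIV trig_partial_deriv riesz_trig_UNIV)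
          show "cmod (csin (n k) x * partial_deriv j (riesz n k) x) \<le> 1 * (2 * pi * 2 ^ k * fsum n k)" for x
            unfolding norm_mult by (intro mult_mono norm_csin_le norm_partial_deriv_riesz_le) auto
        qed
        also have "\<dots> \<le> 2 * pi * 2 ^ K * fsum n k"
          using k by (simp add: mult_right_mono power_increasing)
        finally have "L1_norm (\<lambda>x. of_real (1 / (2 * pi * w k)) * (csin (n k) x * partial_deriv j (riesz n k) x))
            \<le> (1 / (2 * pi * \<bar>w k\<bar>)) * (2 * pi * 2 ^ K * fsum n k)"
          unfolding L1_norm_cmult nw by (intro mult_mono) auto
        also have "\<dots> = 2 ^ K * fsum n k / \<bar>w k\<bar>"
          by simp
        also have "\<dots> \<le> d / K"
          by (rule w'[OF k])
        finally show "L1_norm (\<lambda>x. of_real (1 / (2 * pi * w k)) * (csin (n k) x * partial_deriv j (riesz n k) x)) \<le> d / K" .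
      qed
      also have "\<dots> = d" using K by simp
      finally show ?thesis .
    qed
    have "L1_norm (partial_deriv j f) \<le> (L1_norm g1 + L1_norm g2) + L1_norm g3"
      unfolding pd
      by (intro order.trans[OF L1_norm_add_le[OF trig_add[OF g1 g2] g3]] add_mono
          L1_norm_add_le[OF g1 g2] order_refl)
    also have "\<dots> \<le> (1 * (1 + 1) + 1) + d"
      by (intro add_mono b1 b2 b3)
    finally show ?thesis by simp
  qed

  define W where "W = L1_norm f + (\<Sum>j\<in>UNIV. L1_norm (partial_deriv j f))"
  have "W \<le> (1 + d) + (\<Sum>j\<in>(UNIV::'d set). 3 + d)"
    unfolding W_def by (intro add_mono n0 sum_mono n1)
  then have W: "W \<le> 1 + d + d * (3 + d)"
    by (simp add: d_def)
  have W0: "0 \<le> W" unfolding W_def by (intro add_nonneg_nonneg sum_nonneg) auto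
  have inj: "inj_on n {..<K}"
  proof (rule linorder_inj_onI)
    fix k l assume "k < l" "l \<in> {..<K}"
    then have "freq (n k) < freq (n l)"
      using freq_le_fsum[of k l n] growth1[of l] by auto
    then show "n k \<noteq> n l" by auto
  qed auto
  have "(\<Sum>k<K. (cmod (lam (n k)) / freq (n k))\<^sup>2) \<le> (\<Sum>k<K. (4 * pi)\<^sup>2 * (cmod (lam (n k)) * cmod (fourier_coeff f (n k)))\<^sup>2)"
  proof (intro sum_mono)
    fix k assume "k \<in> {..<K}"
    then have k: "k < K" by simp
    \<comment> \<open>Replacing \<open>freq (n k)\<close> by the smaller coordinate
      \<open>w k\<close> only increases the quotient, and \<open>w k\<close> is what the coefficient
      of \<open>f\<close> contains.\<close>
    have "cmod (lam (n k)) / freq (n k) \<le> cmod (lam (n k)) / \<bar>w k\<bar>"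
      using w(1,3,4)[OF k] by (intro divide_left_mono) auto
    also have "\<dots> = 4 * pi * (cmod (lam (n k)) * cmod (fourier_coeff f (n k)))"
      by (simp add: fc[OF k])
    finally have "(cmod (lam (n k)) / freq (n k))\<^sup>2 \<le> (4 * pi * (cmod (lam (n k)) * cmod (fourier_coeff f (n k))))\<^sup>2"
      by (intro power_mono) auto
    then show "(cmod (lam (n k)) / freq (n k))\<^sup>2 \<le> (4 * pi)\<^sup>2 * (cmod (lam (n k)) * cmod (fourier_coeff f (n k)))\<^sup>2"
      by (simp only: power_mult_distrib mult.assoc)
  qed
  also have "\<dots> = (4 * pi)\<^sup>2 * (\<Sum>m\<in>n ` {..<K}. (cmod (lam m) * cmod (fourier_coeff f m))\<^sup>2)"
    by (simp add: sum.reindex[OF inj] sum_distrib_left)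
  also have "\<dots> \<le> (4 * pi)\<^sup>2 * (C * W)\<^sup>2"
    using lam f unfolding sobolev_multiplier_def W_def by (intro mult_left_mono) auto
  also have "\<dots> \<le> (4 * pi)\<^sup>2 * (C * (1 + d + d * (3 + d)))\<^sup>2"
    using \<open>0 \<le> C\<close> W W0 by (intro mult_left_mono power_mono) auto
  finally show ?thesis
    by (simp add: d_def power_mult_distrib mult.assoc add.assoc)
qed

section \<open>Counting large coefficients\<close>

lemma dyadic_level:
  fixes y :: real
  assumes "1 \<le> y"
  obtains m :: nat where "2 ^ m \<le> y" "y < 2 ^ (m + 1)"
proof -
  define k where "k = nat \<lfloor>y\<rfloor>"
  have k: "1 \<le> k" "real k \<le> y" "y < real (k + 1)"
    unfolding k_def using assms by linarith+
  obtain m where m: "2 ^ m \<le> k" "k + 1 \<le> 2 ^ (m + 1)"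
    using ex_power_ivl1[of 2 k] k(1) by auto
  have "2 ^ m \<le> real k" using m(1) by simp
  then have "2 ^ m \<le> y" using k(2) by linarith
  moreover have "real (k + 1) \<le> real (2 ^ (m + 1))"
    using m(2) by (simp only: of_nat_le_iff)
  then have "y < 2 ^ (m + 1)" using k(3) unfolding of_nat_power by simp
  ultimately show ?thesis by (rule that)
qed

lemma card_le_fibres:
  fixes N :: real
  assumes "finite F" "finite I" "g ` F \<subseteq> I" and N: "\<And>c. c \<in> I \<Longrightarrow> real (card {x \<in> F. g x = c}) \<le> N"
  shows "real (card F) \<le> card I * N"
proof -
  have "real (card F) = (\<Sum>c\<in>I. \<Sum>x\<in>{x \<in> F. g x = c}. 1)"
    using sum.group[OF assms(1-3), of "\<lambda>_. 1::real"] by simp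
  also have "\<dots> \<le> (\<Sum>c\<in>I. N)"
    using N by (intro sum_mono) simp
  finally show ?thesis by simp
qed

text \<open>\<open>block_bound\<close> is used at the upper end R = 2^(m+1) of the block, while each
  coefficient is at least t 2^m by its lower end. The powers of 2 cancel except for one factor 2
  inside the square.\<close>

lemma card_block_le:
  fixes lam :: "int^'d \<Rightarrow> complex"
  assumes lam: "sobolev_multiplier C lam" "0 \<le> C" and "0 < t" "finite F"
    and F: "\<And>n. n \<in> F \<Longrightarrow> 2 ^ m \<le> freq n \<and> freq n < 2 ^ (m + 1) \<and> t \<le> cmod (lam n) / freq n"
  shows "card F \<le> (2 * (C * 3 ^ CARD('d) * (1 + 6 * pi * CARD('d))))\<^sup>2 * (1 / t\<^sup>2)"
proof -
  define D where "D = C * 3 ^ CARD('d) * (1 + 6 * pi * CARD('d))"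
  have "real (card F) * (t * 2 ^ m)\<^sup>2 \<le> (\<Sum>n\<in>F. (cmod (lam n))\<^sup>2)"
  proof -
    have "(t * 2 ^ m)\<^sup>2 \<le> (cmod (lam n))\<^sup>2" if "n \<in> F" for n
    proof (intro power_mono)
      have pos: "0 < freq n" using F[OF that] by (smt (verit) zero_less_power)
      have "t * 2 ^ m \<le> t * freq n"
        using F[OF that] \<open>0 < t\<close> by (intro mult_left_mono) auto
      also have "\<dots> \<le> cmod (lam n)"
        using F[OF that] pos by (simp add: pos_le_divide_eq)
      finally show "t * 2 ^ m \<le> cmod (lam n)" .
    qed (use \<open>0 < t\<close> in auto)
    then have "(\<Sum>n\<in>F. (t * 2 ^ m)\<^sup>2) \<le> (\<Sum>n\<in>F. (cmod (lam n))\<^sup>2)"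
      by (rule sum_mono)
    then show ?thesis by simp
  qed
  also have "\<dots> \<le> (C * 3 ^ CARD('d) * (1 + 6 * pi * CARD('d)) * real (2 ^ (m + 1)))\<^sup>2"
  proof (rule block_bound[OF lam])
    fix n i assume "n \<in> F"
    then have "\<bar>real_of_int (n $ i)\<bar> < 2 ^ (m + 1)"
      using F[of n] abs_nth_le_freq[of n i] by linarith
    then have "real_of_int \<bar>n $ i\<bar> < real_of_int (2 ^ (m + 1))" by simp
    then show "\<bar>n $ i\<bar> \<le> int (2 ^ (m + 1))"
      unfolding of_int_less_iff by simp
  qed (use assms in auto)
  also have "\<dots> = (2 * D)\<^sup>2 * (2 ^ m)\<^sup>2"
    by (simp add: D_def power_mult_distrib)
  finally have "(real (card F) * t\<^sup>2) * (2 ^ m)\<^sup>2 \<le> (2 * D)\<^sup>2 * (2 ^ m)\<^sup>2"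
    by (simp add: power_mult_distrib mult_ac)
  then have "real (card F) * t\<^sup>2 \<le> (2 * D)\<^sup>2"
    by (rule mult_right_le_imp_le) simp
  then show ?thesis
    using \<open>0 < t\<close> unfolding D_def[symmetric] by (simp add: field_simps)
qed

text \<open>With K occupied levels, one frequency from each would satisfy the hypotheses of
  \<open>riesz_bound\<close>, and K terms of size at least \<open>t\<^sup>2\<close> would contradict
  \<open>large\<close>.\<close>

lemma card_levels_less:
  fixes lam :: "int^'d \<Rightarrow> complex" and lev :: "int^'d \<Rightarrow> nat"
  assumes lam: "sobolev_multiplier C lam" "0 \<le> C" and "0 < t" "finite S" and K: "1 \<le> K"
    and large: "(4 * pi * C * (1 + CARD('d) + CARD('d) * (3 + CARD('d))))\<^sup>2 < K * t\<^sup>2"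
    and S: "\<And>n. n \<in> S \<Longrightarrow> 2 ^ lev n \<le> freq n \<and> freq n < 2 ^ (lev n + 1) \<and> t \<le> cmod (lam n) / freq n"
    and res: "\<And>n. n \<in> S \<Longrightarrow> lev n mod (3 * K) = \<rho>"
    and j0: "\<And>n. n \<in> S \<Longrightarrow> freq n \<le> CARD('d) * \<bar>of_int (n $ j0)\<bar>"
    and max: "\<And>n j. n \<in> S \<Longrightarrow> \<bar>n $ j\<bar> \<le> \<bar>n $ j0\<bar>"
    and cell: "\<And>n j. n \<in> S \<Longrightarrow> \<lfloor>K * (of_int (n $ j) / of_int (n $ j0) :: real)\<rfloor> = \<phi> j"
  shows "card (lev ` S) < K"
proof (rule ccontr)
  assume "\<not> card (lev ` S) < K"
  define L where "L = sorted_list_of_set (lev ` S)"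
  have L: "length L \<ge> K" "sorted_wrt (<) L" "set L = lev ` S"
    using \<open>\<not> card (lev ` S) < K\<close> \<open>finite S\<close> by (simp_all add: L_def)
  have "\<exists>n. n \<in> S \<and> lev n = L ! k" if "k < K" for k
  proof -
    have "L ! k \<in> lev ` S" using that L by (metis nth_mem order_less_le_trans)
    then show ?thesis by auto
  qed
  then obtain n where n: "\<And>k. k < K \<Longrightarrow> n k \<in> S" "\<And>k. k < K \<Longrightarrow> lev (n k) = L ! k"
    by metis
  have sep: "lev (n i) + 3 * K \<le> lev (n k)" if "i < k" "k < K" for i k
  proof -
    have "lev (n i) < lev (n k)"
      using that L sorted_wrt_nth_less[OF L(2), of i k] by (simp add: n)
    moreover have "lev (n i) mod (3 * K) = lev (n k) mod (3 * K)"
      using res[OF n(1)[of i]] res[OF n(1)[of k]] that by simp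
    ultimately have "3 * K dvd lev (n k) - lev (n i)" "0 < lev (n k) - lev (n i)"
      by (metis less_imp_le mod_eq_dvd_iff_nat, simp)
    then have "3 * K \<le> lev (n k) - lev (n i)" by (rule dvd_imp_le)
    then show ?thesis using \<open>lev (n i) < lev (n k)\<close> by linarith
  qed
  \<comment> \<open>Squared below to give 4 K^2 <= 4^K. Of the gap 8^K this leaves 2^K, with enough
    room for a factor 2 that makes the growth inequality strict.\<close>
  have K2: "2 * real K \<le> 2 ^ K"
  proof -
    obtain K' where K': "K = Suc K'" using K by (cases K) auto
    have "Suc K' \<le> 2 ^ K'" using less_exp[of K'] by linarith
    then have "real (Suc K') \<le> real (2 ^ K')" unfolding of_nat_le_iff .
    then show ?thesis by (simp add: K')
  qed
  have "(\<Sum>k<K. (cmod (lam (n k)) / freq (n k))\<^sup>2)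
      \<le> (4 * pi * C * (1 + CARD('d) + CARD('d) * (3 + CARD('d))))\<^sup>2"
  \<comment> \<open>The common direction is the lower corner of the cell of side 1/K that contains
    all the normalized directions.\<close>
  proof (rule riesz_bound[OF lam K, where ?j0.0 = j0 and \<theta> = "\<lambda>j. \<phi> j / K"])
    fix k assume k: "k < K"
    define X where "X = fsum n k"
    define Y where "Y = freq (n k)"
    have "Y \<ge> 2 ^ lev (n k)" using S[OF n(1)[OF k]] by (simp add: Y_def)
    then have "Y > 0" by (smt (verit) zero_less_power)
    \<comment> \<open>Levels 3 K apart differ by a factor 8^K; the 2 is lost because
      \<open>freq (n i)\<close> may lie near the top of its block.\<close>
    have "8 ^ K * freq (n i) \<le> 2 * Y" if "i < k" for i
    proof -
      have "8 ^ K * freq (n i) \<le> 2 ^ (3 * K) * 2 ^ (lev (n i) + 1)"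
        using S[of "n i"] n(1)[of i] that k by (intro mult_mono) (auto simp: power_mult)
      also have "\<dots> = 2 * 2 ^ (lev (n i) + 3 * K)"
        by (simp add: power_add)
      also have "\<dots> \<le> 2 * 2 ^ lev (n k)"
        using sep[OF that k] by (intro mult_left_mono power_increasing) auto
      also have "\<dots> \<le> 2 * Y" using \<open>Y \<ge> 2 ^ lev (n k)\<close> by simp
      finally show ?thesis .
    qed
    then have "(\<Sum>i<k. 8 ^ K * freq (n i)) \<le> (\<Sum>i<k. 2 * Y)"
      by (intro sum_mono) auto
    then have "8 ^ K * X \<le> k * (2 * Y)"
      by (simp add: X_def fsum_def sum_distrib_left)
    also have "\<dots> \<le> K * (2 * Y)"
      using k \<open>Y > 0\<close> by (intro mult_right_mono) auto
    finally have "8 ^ K * X \<le> 2 * K * Y" by simp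
    then have "K * (8 ^ K * X) \<le> K * (2 * K * Y)"
      by (intro mult_left_mono) auto
    moreover have "(2 * real K) * (2 * real K) * Y \<le> (2 ^ K * 2 ^ K) * Y"
      using K2 \<open>Y > 0\<close> by (intro mult_right_mono mult_mono) auto
    ultimately have "2 * (K * (8 ^ K * X)) \<le> (2 ^ K * 2 ^ K) * Y"
      by (simp add: algebra_simps)
    moreover have "(8::real) ^ K = (2 ^ K * 2 ^ K) * 2 ^ K"
      by (simp flip: power_mult_distrib)
    ultimately have "(2 ^ K * 2 ^ K) * (2 * (real K * 2 ^ K * X)) \<le> (2 ^ K * 2 ^ K) * Y"
      by (simp add: mult_ac)
    then have "2 * (real K * 2 ^ K * X) \<le> Y"
      by (rule mult_left_le_imp_le) simp
    then show "real K * 2 ^ K * fsum n k < freq (n k)"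
      using \<open>Y > 0\<close> unfolding X_def[symmetric] Y_def[symmetric] by linarith
    show "freq (n k) \<le> CARD('d) * \<bar>of_int (n k $ j0)\<bar>"
      using j0[OF n(1)[OF k]] .
    fix j
    define x where "x = (of_int (n k $ j) / of_int (n k $ j0) :: real)"
    have "\<lfloor>K * x\<rfloor> = \<phi> j" unfolding x_def by (rule cell[OF n(1)[OF k]])
    then have "\<bar>K * x - \<phi> j\<bar> \<le> 1" by linarith
    moreover have "K * x - \<phi> j = K * (x - \<phi> j / K)" using K by (simp add: right_diff_distrib)
    ultimately have "K * \<bar>x - \<phi> j / K\<bar> \<le> 1" by (simp add: abs_mult)
    then show "\<bar>x - \<phi> j / K\<bar> \<le> 1 / K" using K by (simp add: field_simps)
  next
    fix j
    \<comment> \<open>Any member of \<open>S\<close> would do: its coordinate ratios lie in [-1, 1],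
      and their floors determine \<open>\<phi>\<close>.\<close>
    have "n 0 \<in> S" using K by (intro n) auto
    define x where "x = (of_int (n 0 $ j) / of_int (n 0 $ j0) :: real)"
    have "\<bar>real_of_int (n 0 $ j)\<bar> \<le> \<bar>real_of_int (n 0 $ j0)\<bar>"
      using max[OF \<open>n 0 \<in> S\<close>, of j] by linarith
    then have "\<bar>x\<bar> \<le> 1"
      by (simp add: x_def divide_le_eq_1)
    then have "real K * \<bar>x\<bar> \<le> real K * 1" by (intro mult_left_mono) auto
    then have "\<bar>K * x\<bar> \<le> K" by (simp add: abs_mult)
    moreover have "\<lfloor>K * x\<rfloor> = \<phi> j" unfolding x_def by (rule cell[OF \<open>n 0 \<in> S\<close>])
    ultimately have "\<bar>\<phi> j\<bar> \<le> int K" by linarith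
    then have "\<bar>real_of_int (\<phi> j)\<bar> \<le> K" by linarith
    then show "\<bar>\<phi> j / K\<bar> \<le> 1" using K by simp
  qed
  moreover have "K * t\<^sup>2 \<le> (\<Sum>k<K. (cmod (lam (n k)) / freq (n k))\<^sup>2)"
  proof -
    have "(\<Sum>k<K. t\<^sup>2) \<le> (\<Sum>k<K. (cmod (lam (n k)) / freq (n k))\<^sup>2)"
      using S n \<open>0 < t\<close> by (intro sum_mono power_mono) auto
    then show ?thesis by simp
  qed
  ultimately show False using large by linarith
qed

text \<open>Coordinate \<open>j0\<close> of a normalized direction is exactly 1, so its floor after
  scaling by K is K. Fixing it saves one power of K, which is why the number of cones has exponent d
  - 1.\<close>

lemma card_cells:
  "card {\<phi> :: 'd::finite \<Rightarrow> int. \<phi> j0 = int K \<and> (\<forall>j. \<phi> j \<in> {- int K..int K})} = (2 * K + 1) ^ (CARD('d) - 1)"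
  and finite_cells:
  "finite {\<phi> :: 'd::finite \<Rightarrow> int. \<phi> j0 = int K \<and> (\<forall>j. \<phi> j \<in> {- int K..int K})}"
proof -
  define A where "A j = (if j = j0 then {int K} else {- int K..int K})" for j
  have eq: "{\<phi> :: 'd \<Rightarrow> int. \<phi> j0 = int K \<and> (\<forall>j. \<phi> j \<in> {- int K..int K})} = PiE UNIV A"
  proof (intro set_eqI iffI)
    fix \<phi> assume "\<phi> \<in> PiE UNIV A"
    then have "\<phi> j \<in> A j" for j by (simp add: PiE_iff)
    from this[of j0] this show "\<phi> \<in> {\<phi>. \<phi> j0 = int K \<and> (\<forall>j. \<phi> j \<in> {- int K..int K})}"
      unfolding A_def by (smt (verit) atLeastAtMost_iff mem_Collect_eq of_nat_0_le_iff singletonD)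
  qed (simp add: PiE_iff A_def)
  have "(\<Prod>j\<in>UNIV - {j0}. card (A j)) = (\<Prod>j\<in>UNIV - {j0}. 2 * K + 1)"
    by (intro prod.cong refl) (auto simp: A_def)
  also have "\<dots> = (2 * K + 1) ^ (CARD('d) - 1)"
    by (simp add: card_Diff_singleton)
  finally have p: "(\<Prod>j\<in>UNIV - {j0}. card (A j)) = (2 * K + 1) ^ (CARD('d) - 1)" .
  have "card (PiE UNIV A) = card (A j0) * (\<Prod>j\<in>UNIV - {j0}. card (A j))"
    by (simp add: card_PiE prod.remove[of UNIV j0])
  then show "card {\<phi> :: 'd \<Rightarrow> int. \<phi> j0 = int K \<and> (\<forall>j. \<phi> j \<in> {- int K..int K})} = (2 * K + 1) ^ (CARD('d) - 1)"
    unfolding eq p by (simp add: A_def)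
  show "finite {\<phi> :: 'd \<Rightarrow> int. \<phi> j0 = int K \<and> (\<forall>j. \<phi> j \<in> {- int K..int K})}"
    unfolding eq by (intro finite_PiE) (auto simp: A_def)
qed

lemma max_coordinate:
  fixes n :: "int^'d"
  obtains j0 where "\<And>j. \<bar>n $ j\<bar> \<le> \<bar>n $ j0\<bar>" "freq n \<le> CARD('d) * \<bar>of_int (n $ j0)\<bar>"
proof -
  have "Max (range (\<lambda>j. \<bar>n $ j\<bar>)) \<in> range (\<lambda>j. \<bar>n $ j\<bar>)"
    by (intro Max_in) auto
  then obtain j0 where j0: "Max (range (\<lambda>j. \<bar>n $ j\<bar>)) = \<bar>n $ j0\<bar>" by (metis imageE)
  have max: "\<bar>n $ j\<bar> \<le> \<bar>n $ j0\<bar>" for j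
    unfolding j0[symmetric] by (intro Max_ge) auto
  have "freq n \<le> (\<Sum>j\<in>UNIV. \<bar>of_int_vec n $ j\<bar>)"
    unfolding freq_def by (rule norm_le_l1_cart)
  also have "\<dots> \<le> (\<Sum>j\<in>(UNIV::'d set). \<bar>of_int (n $ j0)\<bar>)"
  proof (intro sum_mono)
    fix j show "\<bar>of_int_vec n $ j\<bar> \<le> \<bar>real_of_int (n $ j0)\<bar>"
      using max[of j] by simp
  qed
  finally show ?thesis using max by (intro that[of j0]) auto
qed

lemma card_large_le:
  fixes lam :: "int^'d \<Rightarrow> complex"
  assumes lam: "sobolev_multiplier C lam" "0 \<le> C"
  shows "\<exists>B. \<forall>t F. 0 < t \<longrightarrow> t \<le> 1 \<longrightarrow> finite F \<longrightarrow> F \<subseteq> UNIV - {0} \<longrightarrow>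
    (\<forall>n\<in>F. t \<le> cmod (lam n) / freq n) \<longrightarrow> real (card F) \<le> B * (1 / t\<^sup>2) ^ (CARD('d) + 2)"
proof -
  define d where "d = CARD('d)"
  define A where "A = 4 * pi * C * (1 + CARD('d) + CARD('d) * (3 + CARD('d)))"
  define D where "D = (2 * (C * 3 ^ CARD('d) * (1 + 6 * pi * CARD('d))))\<^sup>2"
  define b where "b = A\<^sup>2 + 1"
  have "d \<ge> 1" by (simp add: d_def Suc_leI)
  have "D \<ge> 0" "b \<ge> 0" by (simp_all add: D_def b_def)
  have "\<forall>n::int^'d. n \<noteq> 0 \<longrightarrow> (\<exists>m. 2 ^ m \<le> freq n \<and> freq n < 2 ^ (m + 1))"
    using dyadic_level freq_ge_1 by metis
  then obtain lev :: "int^'d \<Rightarrow> nat" where lev: "\<And>n. n \<noteq> 0 \<Longrightarrow> 2 ^ lev n \<le> freq n \<and> freq n < 2 ^ (lev n + 1)"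
    by metis
  have "\<exists>j0. \<forall>j. \<bar>n $ j\<bar> \<le> \<bar>n $ j0\<bar> \<and> freq n \<le> CARD('d) * \<bar>of_int (n $ j0)\<bar>" for n :: "int^'d"
    using max_coordinate[of n] by metis
  then obtain J :: "int^'d \<Rightarrow> 'd" where J: "\<And>n j. \<bar>n $ j\<bar> \<le> \<bar>n $ J n\<bar>"
      "\<And>n. freq n \<le> CARD('d) * \<bar>of_int (n $ J n)\<bar>"
    by metis
  have main: "real (card F) \<le> (d * (3 * b) ^ (d - 1) * (3 * b) * b * D) * (1 / t\<^sup>2) ^ (d + 2)"
    if t: "0 < t" "t \<le> 1" and F: "finite F" "F \<subseteq> UNIV - {0}" "\<And>n. n \<in> F \<Longrightarrow> t \<le> cmod (lam n) / freq n" for t F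
  proof -
    define u where "u = 1 / t\<^sup>2"
    have u: "1 \<le> u" using t by (simp add: u_def power_le_one)
    \<comment> \<open>The least integer strictly above \<open>A\<^sup>2 * u\<close>. Strictness
      yields \<open>large\<close>, and u >= 1 keeps K below a constant multiple of u.\<close>
    define K where "K = nat \<lfloor>A\<^sup>2 * u\<rfloor> + 1"
    have "A\<^sup>2 * u \<ge> 0" using u by simp
    then have K: "1 \<le> K" "A\<^sup>2 * u < K" "K \<le> A\<^sup>2 * u + 1"
      unfolding K_def by linarith+
    have Kb: "K \<le> b * u"
      using K(3) u by (simp add: b_def algebra_simps)
    have large: "A\<^sup>2 < K * t\<^sup>2"
      using K(2) t by (simp add: u_def field_simps)
    define \<Phi> where "\<Phi> n j = \<lfloor>K * (of_int (n $ j) / of_int (n $ J n) :: real)\<rfloor>" for n :: "int^'d" and j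
    \<comment> \<open>The label of a frequency: its largest coordinate and cell of direction (the
      cone), and the residue of its dyadic level.\<close>
    define g where "g n = ((J n, \<Phi> n), lev n mod (3 * K))" for n
    define I where "I = (SIGMA j0:(UNIV::'d set). {\<phi>. \<phi> j0 = int K \<and> (\<forall>j. \<phi> j \<in> {- int K..int K})}) \<times> {..<3 * K}"
    have cardI: "card I = d * (2 * K + 1) ^ (d - 1) * (3 * K)"
      unfolding I_def d_def card_cartesian_product card_SigmaI[OF finite ballI[OF finite_cells]] card_cells
      by simp
    have finI: "finite I"
      unfolding I_def by (intro finite_cartesian_product finite_SigmaI finite_cells) auto
    have gI: "g ` F \<subseteq> I"
    proof (rule image_subsetI)
      fix n assume "n \<in> F"
      then have "n \<noteq> 0" using F by auto
      then have nz: "n $ J n \<noteq> 0"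
        using freq_ge_1[of n] J(2)[of n] by (intro notI) simp
      have "\<Phi> n (J n) = int K" using nz by (simp add: \<Phi>_def)
      moreover have "\<Phi> n j \<in> {- int K..int K}" for j
      proof -
        define x where "x = (of_int (n $ j) / of_int (n $ J n) :: real)"
        have "\<bar>real_of_int (n $ j)\<bar> \<le> \<bar>real_of_int (n $ J n)\<bar>"
          using J(1)[of n j] by linarith
        then have "\<bar>x\<bar> \<le> 1" by (simp add: x_def divide_le_eq_1)
        then have "real K * \<bar>x\<bar> \<le> real K * 1" by (intro mult_left_mono) auto
        then have "\<bar>K * x\<bar> \<le> K" by (simp add: abs_mult)
        then have "\<lfloor>K * x\<rfloor> \<in> {- int K..int K}"
          by (simp add: le_floor_iff floor_le_iff abs_le_iff)
        then show ?thesis by (simp add: \<Phi>_def x_def)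
      qed
      ultimately show "g n \<in> I" using K by (simp add: g_def I_def)
    qed
    have fibre: "real (card {n \<in> F. g n = c}) \<le> K * (D * u)" for c
    proof -
      obtain j0 \<phi> \<rho> where c: "c = ((j0, \<phi>), \<rho>)" by (metis prod.collapse)
      define S where "S = {n \<in> F. g n = c}"
      have finS: "finite S" using F by (simp add: S_def)
      have S: "n \<noteq> 0" "t \<le> cmod (lam n) / freq n" "J n = j0" "\<Phi> n = \<phi>" "lev n mod (3 * K) = \<rho>" if "n \<in> S" for n
        using that F by (auto simp: S_def c g_def)
      have "card (lev ` S) < K"
      proof (rule card_levels_less[OF lam t(1) finS K(1) large[unfolded A_def]])
        show "\<lfloor>K * (of_int (n $ j) / of_int (n $ j0) :: real)\<rfloor> = \<phi> j" if "n \<in> S" for n j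
          using S[OF that] unfolding \<Phi>_def by auto
        show "freq n \<le> CARD('d) * \<bar>of_int (n $ j0)\<bar>" if "n \<in> S" for n
          using J(2)[of n] S(3)[OF that] by simp
        show "\<bar>n $ j\<bar> \<le> \<bar>n $ j0\<bar>" if "n \<in> S" for n j
          using J(1)[of n j] S(3)[OF that] by simp
      qed (use S lev in auto)
      moreover have "real (card S) \<le> card (lev ` S) * (D * u)"
      proof (rule card_le_fibres[OF finS finite_imageI[OF finS] order_refl])
        fix m
        show "real (card {n \<in> S. lev n = m}) \<le> D * u"
          unfolding D_def u_def
          using finS S lev by (intro card_block_le[OF lam t(1), where m = m]) auto
      qed
      moreover have "card (lev ` S) * (D * u) \<le> K * (D * u)" if "card (lev ` S) < K"
        using that \<open>D \<ge> 0\<close> u by (intro mult_right_mono) auto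
      ultimately show ?thesis unfolding S_def by linarith
    qed
    have "real (card F) \<le> card I * (K * (D * u))"
      by (rule card_le_fibres[OF F(1) finI gI fibre])
    also have "\<dots> = d * real (2 * K + 1) ^ (d - 1) * (3 * K) * (K * (D * u))"
      by (simp add: cardI)
    also have "\<dots> \<le> d * (3 * b * u) ^ (d - 1) * (3 * (b * u)) * ((b * u) * (D * u))"
    proof -
      have "real (2 * K + 1) \<le> 3 * b * u" using Kb K(1) by simp
      then show ?thesis
        using Kb \<open>D \<ge> 0\<close> \<open>b \<ge> 0\<close> u by (intro mult_mono power_mono mult_nonneg_nonneg) auto
    qed
    also have "\<dots> = (d * (3 * b) ^ (d - 1) * (3 * b) * b * D) * (u ^ (d - 1) * u * u * u)"
      by (simp add: power_mult_distrib mult_ac)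
    \<comment> \<open>The powers of u come from the cones (d - 1), the residue classes, the levels
      in a class, and the size of a block.\<close>
    also have "u ^ (d - 1) * u * u * u = u ^ (d + 2)"
      using \<open>d \<ge> 1\<close> by (cases d) simp_all
    finally show ?thesis by (simp add: u_def)
  qed
  show ?thesis
  proof (intro exI allI impI)
    fix t :: real and F :: "(int^'d) set"
    assume "0 < t" "t \<le> 1" "finite F" "F \<subseteq> UNIV - {0}" "\<forall>n\<in>F. t \<le> cmod (lam n) / freq n"
    then show "real (card F) \<le> (d * (3 * b) ^ (d - 1) * (3 * b) * b * D) * (1 / t\<^sup>2) ^ (CARD('d) + 2)"
      unfolding d_def[symmetric] by (intro main) auto
  qed
qed

text \<open>Split the values below 1 dyadically. The level with values about 2^(-j) has at most
  \<open>B * 4 ^ q * 4 ^ (q * j)\<close> members, each contributing at most 2^(-p j), so the levels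
  are dominated by a geometric series.\<close>

lemma summable_powr_of_counting:
  fixes a :: "'a \<Rightarrow> real"
  assumes a: "\<And>n. n \<in> S \<Longrightarrow> 0 \<le> a n"
    and count: "\<And>t F. 0 < t \<Longrightarrow> t \<le> 1 \<Longrightarrow> finite F \<Longrightarrow> F \<subseteq> S \<Longrightarrow> (\<And>n. n \<in> F \<Longrightarrow> t \<le> a n)
      \<Longrightarrow> real (card F) \<le> B * (1 / t\<^sup>2) ^ q"
    and p: "2 * real q < p"
  shows "(\<lambda>n. a n powr p) summable_on S"
proof -
  have "B \<ge> 0" using count[of 1 "{}"] by simp
  \<comment> \<open>The values from 1 upward have no dyadic level below 1. The counting bound at t =
    1 shows that there are finitely many of them.\<close>
  define S1 where "S1 = {n \<in> S. 1 \<le> a n}"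
  have "finite S1"
  proof (rule ccontr)
    assume "infinite S1"
    then obtain F where F: "finite F" "card F = nat \<lceil>B\<rceil> + 1" "F \<subseteq> S1"
      using infinite_arbitrarily_large by blast
    then have "real (card F) \<le> B * (1 / 1\<^sup>2) ^ q"
      by (intro count) (auto simp: S1_def)
    then show False using F(2) by simp linarith
  qed
  \<comment> \<open>Ratio of the geometric series: 4^q is the growth of the count per level and
    2^(-p) the decay of a term; \<open>2 * q < p\<close> makes it less than 1.\<close>
  define r where "r = 4 ^ q * (1 / 2) powr p"
  have r: "0 \<le> r" "r < 1"
  proof -
    have "r = 2 powr (2 * real q - p)"
      unfolding r_def by (simp add: powr_diff powr_divide powr_mult_base flip: powr_powr powr_realpow)
    then show "0 \<le> r" "r < 1" using p by (simp_all add: powr_less_one)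
  qed
  have "(\<lambda>n. a n powr p) summable_on (S - S1)"
  proof (rule nonneg_bdd_above_summable_on)
    show "bdd_above (sum (\<lambda>n. a n powr p) ` {F. F \<subseteq> S - S1 \<and> finite F})"
    proof (intro bdd_aboveI2)
      fix F assume "F \<in> {F. F \<subseteq> S - S1 \<and> finite F}"
      then have F: "finite F" "F \<subseteq> S - S1" by auto
      \<comment> \<open>Zero values have no dyadic level, and their powers are 0.\<close>
      define F' where "F' = {n \<in> F. 0 < a n}"
      have F': "finite F'" "F' \<subseteq> S" "\<And>n. n \<in> F' \<Longrightarrow> 0 < a n \<and> a n < 1"
        using F by (auto simp: F'_def S1_def)
      have "\<exists>j. (1/2) ^ (j + 1) \<le> a n \<and> a n \<le> (1/2) ^ j" if "n \<in> F'" for n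
      proof -
        have an: "0 < a n" "a n < 1" using F'(3)[OF that] by auto
        then have "1 \<le> 1 / a n" by simp
        then obtain j where "2 ^ j \<le> 1 / a n" "1 / a n < 2 ^ (j + 1)"
          by (rule dyadic_level)
        then show ?thesis
          using an by (intro exI[of _ j]) (simp add: power_one_over field_simps)
      qed
      then obtain l where l: "\<And>n. n \<in> F' \<Longrightarrow> (1/2) ^ (l n + 1) \<le> a n \<and> a n \<le> (1/2) ^ l n"
        by metis
      have "(\<Sum>n\<in>F. a n powr p) = (\<Sum>n\<in>F'. a n powr p)"
        using F a by (intro sum.mono_neutral_right) (auto simp: F'_def less_le)
      also have "\<dots> = (\<Sum>j\<in>l ` F'. \<Sum>n\<in>{n \<in> F'. l n = j}. a n powr p)"
        using F' by (intro sum.group[symmetric]) auto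
      also have "\<dots> \<le> (\<Sum>j\<in>l ` F'. B * 4 ^ q * r ^ j)"
      proof (intro sum_mono)
        fix j
        have half: "((1/2) ^ j) powr p = ((1/2) powr p) ^ j" for j :: nat
          by (simp add: powr_power powr_powr mult.commute flip: powr_realpow)
        have "(\<Sum>n\<in>{n \<in> F'. l n = j}. a n powr p) \<le> (\<Sum>n\<in>{n \<in> F'. l n = j}. ((1/2) powr p) ^ j)"
          unfolding half[symmetric] using F'(3) l p
          by (intro sum_mono powr_mono2) (auto simp: less_imp_le)
        also have "\<dots> = real (card {n \<in> F'. l n = j}) * ((1/2) powr p) ^ j"
          by simp
        also have "\<dots> \<le> (B * (1 / ((1/2) ^ (j + 1))\<^sup>2) ^ q) * ((1/2) powr p) ^ j"
        proof (intro mult_right_mono count)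
          show "(1/2 :: real) ^ (j + 1) \<le> 1" by (rule power_le_one) auto
          show "(1/2) ^ (j + 1) \<le> a n" if "n \<in> {n \<in> F'. l n = j}" for n
            using l[of n] that by auto
        qed (use F' in auto)
        also have "(1 / ((1/2 :: real) ^ (j + 1))\<^sup>2) = 4 * 4 ^ j"
        proof -
          have "((1/2 :: real) ^ (j + 1))\<^sup>2 = (1/4) ^ (j + 1)"
            by (simp only: power_even_eq[symmetric] power_mult[symmetric] mult.commute[of _ 2])
              (simp add: power_mult power2_eq_square power_divide)
          then show ?thesis by (simp add: power_divide)
        qed
        also have "B * (4 * 4 ^ j) ^ q * ((1/2) powr p) ^ j = B * 4 ^ q * r ^ j"
          by (simp add: r_def power_mult_distrib mult_ac flip: power_mult)
        finally show "(\<Sum>n\<in>{n \<in> F'. l n = j}. a n powr p) \<le> B * 4 ^ q * r ^ j" .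
      qed
      also have "\<dots> = B * 4 ^ q * (\<Sum>j\<in>l ` F'. r ^ j)"
        by (simp add: sum_distrib_left)
      also have "\<dots> \<le> B * 4 ^ q * (\<Sum>j. r ^ j)"
        using r \<open>B \<ge> 0\<close> F' by (intro mult_left_mono sum_le_suminf summable_geometric) auto
      finally show "(\<Sum>n\<in>F. a n powr p) \<le> B * 4 ^ q * (\<Sum>j. r ^ j)" .
    qed
  qed auto
  moreover have "(\<lambda>n. a n powr p) summable_on S1"
    using \<open>finite S1\<close> by (rule summable_on_finite)
  ultimately have "(\<lambda>n. a n powr p) summable_on ((S - S1) \<union> S1)"
    by (rule summable_on_Un_disjoint) auto
  moreover have "(S - S1) \<union> S1 = S" by (auto simp: S1_def)
  ultimately show ?thesis by simp
qed

theorem theorem2: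
  fixes T :: "(real^'d \<Rightarrow> complex) \<Rightarrow> (real^'d \<Rightarrow> complex)"
    and lam :: "int^'d \<Rightarrow> complex"
    and \<epsilon> :: real
  assumes "bounded_linear_operator T"
    and "translation_invariant T"
    and "\<And>f n. f \<in> W11 \<Longrightarrow> fourier_coeff (T f) n = lam n * fourier_coeff f n"
    and "\<epsilon> > 0"
  shows "(\<lambda>n. (cmod (lam n) / norm (of_int_vec n)) powr (2 * real CARD('d) + 4 + \<epsilon>))
           summable_on (UNIV - {0})"
proof -
  obtain C where C: "sobolev_multiplier C lam" "0 \<le> C"
    using bounded_imp_sobolev_multiplier[OF assms(1,3)] by blast
  obtain B where B: "\<forall>t F. 0 < t \<longrightarrow> t \<le> 1 \<longrightarrow> finite F \<longrightarrow> F \<subseteq> UNIV - {0} \<longrightarrow>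
      (\<forall>n\<in>F. t \<le> cmod (lam n) / freq n) \<longrightarrow> real (card F) \<le> B * (1 / t\<^sup>2) ^ (CARD('d) + 2)"
    using card_large_le[OF C] by blast
  show ?thesis
    unfolding freq_def[symmetric]
  \<comment> \<open>With q = d + 2 the threshold 2 q is 2 d + 4, and the positive \<epsilon> puts
    the exponent strictly above it.\<close>
  proof (rule summable_powr_of_counting[where B = B and q = "CARD('d) + 2"])
    show "2 * real (CARD('d) + 2) < 2 * real CARD('d) + 4 + \<epsilon>" using assms(4) by simp
    show "real (card F) \<le> B * (1 / t\<^sup>2) ^ (CARD('d) + 2)"
      if "0 < t" "t \<le> 1" "finite F" "F \<subseteq> UNIV - {0}" "\<And>n. n \<in> F \<Longrightarrow> t \<le> cmod (lam n) / freq n" for t F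
      using that by (intro B[rule_format]) auto
  qed simp
qed

end
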